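(* Let $M$ be a finite measure on $\mathbb X$ with $M(\mathrm dx)=m(x)\,\ell(\mathrm dx)$, and let $\mu$ be the probability measure $\mu(\mathrm dx)=\frac{m(x)}{M(\mathbb X)}\,\ell(\mathrm dx)$. Let $\Phi$ be a purely random point process on $\mathbb X$ supported by $\mu$ and a probability distribution $(p_n)_{n\ge0}$ on $\{0,1,2,\dots\}$ such that $p_n\ne0$ for any $n\ge0$. Then $$\Delta_{TV}^*(\Phi,\zeta_M)\le\sum_{n=0}^{+\infty}\big|(n+1)p_{n+1}-M(\mathbb X)p_n\big|,$$ where $\zeta_M$ is the Poisson point process on $\mathbb X$ with intensity measure $M$.
   Context: $\mathbb X$ is a locally compact metric space with its Borel $\sigma$-algebra, and $\ell$ is a Radon measure on $\mathbb X$ (not necessarily diffuse). Configurations are nonnegative-integer-valued measures on $\mathbb X$ finite on relatively compact Borel sets (treated as multisets of points), with the smallest $\sigma$-algebra making $\phi\mapsto\phi(A)$ measurable for every relatively compact Borel $A$; a point process is a random configuration. A purely random point process supported by $\mu$ and $(p_n)_{n\ge0}$ is a finite point process whose number of points $N$ satisfies $\mathbb P(N=n)=p_n$ and which, conditionally on $N$, consists of $N$ points drawn independently according to $\mu$. For measures $\nu_1,\nu_2$ on $\mathbb X$, $\Delta_{TV}(\nu_1,\nu_2)=\sup|\nu_1(A)-\nu_2(A)|$, the supremum being over Borel $A$ with $\nu_1(A),\nu_2(A)<\infty$. For point processes $\Phi_1,\Phi_2$ with laws $\mathbb P_1,\mathbb P_2$, $\Delta_{TV}^*(\Phi_1,\Phi_2)=\inf_{\mathbf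 C}\int\Delta_{TV}(\omega_1,\omega_2)\,\mathbf C(\mathrm d(\omega_1,\omega_2))$, the infimum being over all couplings $\mathbf C$ of $\mathbb P_1$ and $\mathbb P_2$. *)

theory Defs
  imports "HOL-Probability.Probability"
begin

definition radon_measure :: "'a::metric_space measure \<Rightarrow> bool" where
  "radon_measure L \<longleftrightarrow> sets L = sets borel
     \<and> (\<forall>K. compact K \<longrightarrow> emeasure L K < \<infinity>)
     \<and> (\<forall>A\<in>sets borel. emeasure L A = (SUP K\<in>{K. compact K \<and> K \<subseteq> A}. emeasure L K))"

definition rel_compact_borel :: "'a::metric_space set set" where
  "rel_compact_borel = {A \<in> sets borel. compact (closure A)}"

definition configurations :: "'a::metric_space measure set" where
  "configurations = {\<phi>. sets \<phi> = sets borel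
     \<and> (\<forall>A\<in>sets borel. emeasure \<phi> A \<in> range ennreal_of_enat)
     \<and> (\<forall>A\<in>rel_compact_borel. emeasure \<phi> A < \<infinity>)}"

definition config_space :: "'a::metric_space measure measure" where
  "config_space =
     (SUP A\<in>rel_compact_borel. vimage_algebra configurations (\<lambda>\<phi>. emeasure \<phi> A) borel)"

text \<open>A point process is a random element \<open>\<Phi>\<close> of the configuration space, defined on a
  probability space \<open>P\<close>; its law is the image measure.\<close>

definition point_process :: "'w measure \<Rightarrow> ('w \<Rightarrow> 'a::metric_space measure) \<Rightarrow> bool" where
  "point_process P \<Phi> \<longleftrightarrow> prob_space P \<and> \<Phi> \<in> measurable P config_space"

definition pp_law :: "'w measure \<Rightarrow> ('w \<Rightarrow> 'a::metric_space measure) \<Rightarrow> 'a measure measure" where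
  "pp_law P \<Phi> = distr P config_space \<Phi>"

text \<open>The configuration \<open>\<delta>\<^bsub>x 0\<^esub> + \<dots> + \<delta>\<^bsub>x (n - 1)\<^esub>\<close>, points being counted with
  multiplicity, is the image of the counting measure on \<open>{..<n}\<close> under \<open>x\<close>.\<close>

definition points_config :: "nat \<Rightarrow> (nat \<Rightarrow> 'a::metric_space) \<Rightarrow> 'a measure" where
  "points_config n x = distr (count_space {..<n}) borel x"

text \<open>Given that the number of points is \<open>n\<close>, the process is distributed as the configuration of
  \<open>n\<close> independent points of law \<open>\<mu>\<close>. The process is almost surely finite because the weights
  of the distribution \<open>p\<close> on the natural numbers sum to 1.\<close>

definition purely_random_pp ::
  "'w measure \<Rightarrow> ('w \<Rightarrow> 'a::metric_space measure) \<Rightarrow> 'a measure \<Rightarrow> nat pmf \<Rightarrow> bool" where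
  "purely_random_pp P \<Phi> \<mu> p \<longleftrightarrow> point_process P \<Phi> \<and> prob_space \<mu> \<and> sets \<mu> = sets borel
     \<and> (\<forall>n. \<P>(\<omega> in P. emeasure (\<Phi> \<omega>) UNIV = of_nat n) = pmf p n)
     \<and> (\<forall>n. pmf p n \<noteq> 0 \<longrightarrow> (\<forall>B\<in>sets config_space.
          \<P>(\<omega> in P. \<Phi> \<omega> \<in> B \<bar> emeasure (\<Phi> \<omega>) UNIV = of_nat n)
            = \<P>(x in Pi\<^sub>M {..<n} (\<lambda>_. \<mu>). points_config n x \<in> B)))"

text \<open>The Poisson probabilities are written out, since \<open>poisson_pmf\<close> excludes rate 0.\<close>

definition poisson_pp ::
  "'w measure \<Rightarrow> ('w \<Rightarrow> 'a::metric_space measure) \<Rightarrow> 'a measure \<Rightarrow> bool" where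
  "poisson_pp P \<zeta> M \<longleftrightarrow> point_process P \<zeta> \<and> sets M = sets borel
     \<and> (\<forall>A\<in>rel_compact_borel. emeasure M A < \<infinity>)
     \<and> (\<forall>A\<in>rel_compact_borel. \<forall>k.
          \<P>(\<omega> in P. emeasure (\<zeta> \<omega>) A = of_nat k) = measure M A ^ k / fact k * exp (- measure M A))
     \<and> (\<forall>n. \<forall>A :: nat \<Rightarrow> 'a set.
          (\<forall>i<n. A i \<in> rel_compact_borel) \<and> disjoint_family_on A {..<n} \<longrightarrow>
          prob_space.indep_vars P (\<lambda>_. borel) (\<lambda>i \<omega>. emeasure (\<zeta> \<omega>) (A i)) {..<n})"

definition tv_dist :: "'a::metric_space measure \<Rightarrow> 'a measure \<Rightarrow> ennreal" where
  "tv_dist \<nu>1 \<nu>2 =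
     (SUP A\<in>{A \<in> sets borel. emeasure \<nu>1 A < \<infinity> \<and> emeasure \<nu>2 A < \<infinity>}.
        ennreal \<bar>measure \<nu>1 A - measure \<nu>2 A\<bar>)"

definition couplings :: "'b measure \<Rightarrow> 'c measure \<Rightarrow> ('b \<times> 'c) measure set" where
  "couplings P1 P2 = {C. sets C = sets (P1 \<Otimes>\<^sub>M P2) \<and> distr C P1 fst = P1 \<and> distr C P2 snd = P2}"

text \<open>The distance of two point processes, as a function of their laws. If the space is not
  separable then \<open>tv_dist\<close> need not be measurable, and the integral is the supremum of
  the integrals of the simple functions below the integrand.\<close>

definition tv_star :: "'a::metric_space measure measure \<Rightarrow> 'a measure measure \<Rightarrow> ennreal" where
  "tv_star P1 P2 = (INF C\<in>couplings P1 P2. \<integral>\<^sup>+\<omega>. tv_dist (fst \<omega>) (snd \<omega>) \<partial>C)"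

end

theory Submission
  imports Defs
begin

text \<open>Write \<open>r\<close> for the total mass of \<open>M\<close>. Both processes are mixtures of configurations of finitely
  many independent points of law \<open>\<mu>\<close>, with a number of points of law \<open>p\<close>, respectively Poisson of mean
  \<open>r\<close>. Using the same points for both and the quantile coupling of the numbers of points, the
  distance is at most the Wasserstein distance \<open>(\<Sum>k. \<bar>P(X > k) - P(Y > k)\<bar>)\<close> of these two laws on the
  natural numbers. With \<open>q\<close> the Poisson weights, the increments of the likelihood ratio are
  \<open>p (n + 1) / q (n + 1) - p n / q n = ((n + 1) p (n + 1) - r p n) / (r q n)\<close>; expanding the tail
  differences in these increments and summing the resulting kernel, which is a Poisson covariance
  evaluated by Stein's identity, makes the factors \<open>r q n\<close> cancel.

  That the law of the Poisson process is such a mixture follows since a law on configurations is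
  determined by the joint laws of the numbers of points in disjoint relatively compact sets.\<close>

section \<open>The law of a point process is determined by disjoint counts\<close>

lemma empty_in_rel_compact_borel: "{} \<in> rel_compact_borel"
  by (simp add: rel_compact_borel_def)

lemma rel_compact_borel_subset:
  assumes "A \<in> rel_compact_borel" "B \<in> sets borel" "B \<subseteq> A"
  shows "B \<in> rel_compact_borel"
proof -
  have "closure B = closure A \<inter> closure B"
    using closure_mono[OF assms(3)] by auto
  then have "compact (closure B)"
    using assms(1) compact_Int_closed[of "closure A" "closure B"]
    by (auto simp: rel_compact_borel_def)
  then show ?thesis
    using assms(2) by (simp add: rel_compact_borel_def)
qed

lemma space_config_space: "space config_space = configurations"
  unfolding config_space_def space_Sup_eq_UN
  \<comment> \<open>The space of a supremum of measures is the union of their spaces; the empty set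
    makes the index family nonempty, so the union is all of \<open>configurations\<close>.\<close>
  using empty_in_rel_compact_borel by auto

lemma emeasure_eval_measurable:
  assumes "A \<in> rel_compact_borel"
  shows "(\<lambda>\<phi>. emeasure \<phi> A) \<in> borel_measurable config_space"
proof (rule measurableI)
  fix B :: "ennreal set" assume B: "B \<in> sets borel"
  have "(\<lambda>\<phi>. emeasure \<phi> A) -` B \<inter> configurations
      \<in> sets (vimage_algebra configurations (\<lambda>\<phi>. emeasure \<phi> A) borel)"
    using B by (rule in_vimage_algebra)
  then show "(\<lambda>\<phi>. emeasure \<phi> A) -` B \<inter> space config_space \<in> sets config_space"
    unfolding space_config_space unfolding config_space_def
    using assms by (intro in_sets_Sup[where X=configurations]) auto
qed simp

text \<open>The universal property of the supremum: preimages need only be checked on the generators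
  of \<open>config_space\<close>, which are preimages of Borel sets under evaluations.\<close>

lemma measurable_into_config_space:
  fixes f :: "'w \<Rightarrow> 'a::metric_space measure"
  assumes conf: "\<And>\<omega>. \<omega> \<in> space N \<Longrightarrow> f \<omega> \<in> configurations"
    and meas: "\<And>A. A \<in> rel_compact_borel \<Longrightarrow> (\<lambda>\<omega>. emeasure (f \<omega>) A) \<in> borel_measurable N"
  shows "f \<in> measurable N config_space"
proof -
  let ?V = "\<lambda>A :: 'a set. vimage_algebra configurations (\<lambda>\<phi>. emeasure \<phi> A) borel"
  have "sets config_space = sigma_sets configurations (\<Union>V\<in>?V ` rel_compact_borel. sets V)"
    unfolding config_space_def
    by (rule sets_Sup_eq) (use empty_in_rel_compact_borel in auto)
  then show ?thesis
  proof (rule measurable_sigma_sets)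
    fix Y assume "Y \<in> (\<Union>V\<in>?V ` rel_compact_borel. sets V)"
    then obtain A where A: "A \<in> rel_compact_borel" "Y \<in> sets (?V A)"
      by auto
    then obtain B where B: "B \<in> sets borel" "Y = (\<lambda>\<phi>. emeasure \<phi> A) -` B \<inter> configurations"
      by (auto simp: sets_vimage_algebra2)
    then have "f -` Y \<inter> space N = (\<lambda>\<omega>. emeasure (f \<omega>) A) -` B \<inter> space N"
      using conf by auto
    then show "f -` Y \<inter> space N \<in> sets N"
      using measurable_sets[OF meas[OF A(1)] B(1)] by simp
  next
    show "f \<in> space N \<rightarrow> configurations"
      using conf by auto
    have "sets (?V A) \<subseteq> Pow configurations" for A
      using sets.space_closed[of "?V A"] by simp
    then show "(\<Union>V\<in>?V ` rel_compact_borel. sets V) \<subseteq> Pow configurations"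
      by blast
  qed
qed

text \<open>An extended natural number that is finite is a natural number. Hence evaluations take
  only countably many values, and events fixing exact counts suffice below.\<close>

lemma configuration_value:
  assumes "\<phi> \<in> configurations" "A \<in> rel_compact_borel"
  obtains k :: nat where "emeasure \<phi> A = of_nat k"
proof -
  have "A \<in> sets borel"
    using assms(2) by (simp add: rel_compact_borel_def)
  then have "emeasure \<phi> A \<in> range ennreal_of_enat" "emeasure \<phi> A < \<infinity>"
    using assms by (auto simp: configurations_def)
  then obtain e where e: "emeasure \<phi> A = ennreal_of_enat e" "ennreal_of_enat e < \<infinity>"
    by auto
  then show ?thesis
    using that by (cases e) auto
qed

text \<open>The sets \<open>A i\<close> may overlap here, which makes the family of cylinders closed
  under intersection. Only the values of \<open>A\<close> and \<open>k\<close> below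
  \<open>n\<close> matter.\<close>

definition cylinder :: "nat \<Rightarrow> (nat \<Rightarrow> 'a::metric_space set) \<Rightarrow> (nat \<Rightarrow> nat) \<Rightarrow> 'a measure set" where
  "cylinder n A k = {\<phi> \<in> configurations. \<forall>i<n. emeasure \<phi> (A i) = of_nat (k i)}"

lemma sets_cylinder:
  assumes "\<And>i. i < n \<Longrightarrow> A i \<in> rel_compact_borel"
  shows "cylinder n A k \<in> sets config_space"
proof -
  have [measurable]: "(\<lambda>\<phi>. emeasure \<phi> (A i)) \<in> borel_measurable config_space" if "i < n" for i
    using emeasure_eval_measurable assms that by blast
  have "{\<phi> \<in> space config_space. \<forall>i\<in>{..<n}. emeasure \<phi> (A i) = of_nat (k i)} \<in> sets config_space"
    by (intro sets.sets_Collect_finite_All) auto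
  also have "{\<phi> \<in> space config_space. \<forall>i\<in>{..<n}. emeasure \<phi> (A i) = of_nat (k i)} = cylinder n A k"
    by (auto simp: cylinder_def space_config_space)
  finally show ?thesis .
qed

definition cylinders :: "'a::metric_space measure set set" where
  "cylinders = {cylinder n A k | n A k. \<forall>i<n. A i \<in> rel_compact_borel}"

text \<open>Two finite lists of constraints are concatenated, the second being shifted by
  \<open>n\<close>.\<close>

lemma Int_stable_cylinders: "Int_stable cylinders"
proof (rule Int_stableI)
  fix X Y :: "'a measure set" assume "X \<in> cylinders" "Y \<in> cylinders"
  then obtain n A k n' A' k' where
    X: "X = cylinder n A k" "\<forall>i<n. A i \<in> rel_compact_borel" and
    Y: "Y = cylinder n' A' k'" "\<forall>i<n'. A' i \<in> rel_compact_borel"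
    by (auto simp: cylinders_def)
  have split: "(\<forall>i<n+n'. R i) \<longleftrightarrow> (\<forall>i<n. R i) \<and> (\<forall>i<n'. R (n + i))" for R :: "nat \<Rightarrow> bool"
  proof (intro iffI conjI allI impI)
    fix i assume R: "(\<forall>i<n. R i) \<and> (\<forall>i<n'. R (n + i))" and i: "i < n + n'"
    show "R i"
    proof (cases "i < n")
      case False
      then have "R (n + (i - n))"
        using R i by (intro R[THEN conjunct2, rule_format]) auto
      then show ?thesis
        using False by simp
    qed (use R in auto)
  qed auto
  have "X \<inter> Y = cylinder (n + n') (\<lambda>i. if i < n then A i else A' (i - n))
      (\<lambda>i. if i < n then k i else k' (i - n))"
    unfolding X Y cylinder_def split by auto
  moreover have "\<forall>i<n+n'. (if i < n then A i else A' (i - n)) \<in> rel_compact_borel"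
    unfolding split using X Y by auto
  ultimately show "X \<inter> Y \<in> cylinders"
    unfolding cylinders_def by blast
qed

lemma sets_config_space_cylinders:
  "sets (config_space :: 'a::metric_space measure measure) = sigma_sets configurations cylinders"
proof
  have sub: "(cylinders :: 'a measure set set) \<subseteq> Pow configurations"
    by (auto simp: cylinders_def cylinder_def)
  show "sigma_sets configurations cylinders \<subseteq> sets (config_space :: 'a measure measure)"
    unfolding space_config_space[symmetric]
    by (rule sets.sigma_sets_subset) (auto simp: cylinders_def intro: sets_cylinder)
  let ?S = "sigma configurations cylinders :: 'a measure measure"
  \<comment> \<open>Measurability of the identity between two structures on the same space is the
    inclusion of their \<sigma>-algebras.\<close>
  have *: "(\<lambda>\<phi>. \<phi>) \<in> measurable ?S config_space"
  proof (rule measurable_into_config_space)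
    fix A :: "'a set" assume A: "A \<in> rel_compact_borel"
    show "(\<lambda>\<phi>. emeasure \<phi> A) \<in> borel_measurable ?S"
    proof (rule measurableI)
      fix B :: "ennreal set"
      \<comment> \<open>The counts are natural numbers, so every preimage is a countable union of
        cylinders with a single constraint.\<close>
      have "(\<lambda>\<phi>. emeasure \<phi> A) -` B \<inter> space ?S
          = (\<Union>k\<in>{k. of_nat k \<in> B}. cylinder 1 (\<lambda>_. A) (\<lambda>_. k))"
      proof (intro equalityI subsetI)
        fix \<phi> assume "\<phi> \<in> (\<lambda>\<phi>. emeasure \<phi> A) -` B \<inter> space ?S"
        then have \<phi>: "\<phi> \<in> configurations" "emeasure \<phi> A \<in> B"
          by (simp_all add: sub)
        obtain k where "emeasure \<phi> A = of_nat k"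
          using configuration_value[OF \<phi>(1) A] .
        then show "\<phi> \<in> (\<Union>k\<in>{k. of_nat k \<in> B}. cylinder 1 (\<lambda>_. A) (\<lambda>_. k))"
          using \<phi> by (auto simp: cylinder_def)
      qed (auto simp: cylinder_def sub)
      also have "\<dots> \<in> sets ?S"
      proof (rule sets.countable_UN'')
        have "cylinder 1 (\<lambda>_. A) (\<lambda>_. k) \<in> cylinders" for k
          using A unfolding cylinders_def by blast
        then show "cylinder 1 (\<lambda>_. A) (\<lambda>_. k) \<in> sets ?S" for k
          using sub by auto
      qed simp
      finally show "(\<lambda>\<phi>. emeasure \<phi> A) -` B \<inter> space ?S \<in> sets ?S" .
    qed simp
  qed (simp add: sub)
  show "sets (config_space :: 'a measure measure) \<subseteq> sigma_sets configurations cylinders"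
  proof (intro subsetI)
    fix Y :: "'a measure set" assume Y: "Y \<in> sets config_space"
    have "Y \<subseteq> configurations"
      using sets.sets_into_space[OF Y] by (simp add: space_config_space)
    then have "(\<lambda>\<phi>. \<phi>) -` Y \<inter> space ?S = Y"
      by (auto simp: sub)
    then show "Y \<in> sigma_sets configurations cylinders"
      using measurable_sets[OF * Y] sub by simp
  qed
qed

text \<open>The sets \<open>D j\<close> are the atoms of the finite algebra generated by the
  \<open>A i\<close>: two points share an atom if they lie in the same sets
  \<open>A i\<close>.\<close>

lemma disjoint_refinement:
  fixes A :: "nat \<Rightarrow> 'a::metric_space set"
  assumes A': "\<forall>i<n. A i \<in> rel_compact_borel"
  shows "\<exists>N :: nat. \<exists>D. (\<forall>j<N. D j \<in> rel_compact_borel) \<and> disjoint_family_on D {..<N} \<and>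
    (\<forall>i<n. A i = (\<Union>j\<in>{j\<in>{..<N}. D j \<subseteq> A i}. D j))"
proof -
  note A = A'[rule_format]
  define type where "type x = {i \<in> {..<n}. x \<in> A i}" for x
  define atom where "atom x = {y. type y = type x}" for x
  \<comment> \<open>Only atoms inside some \<open>A i\<close> are kept: they inherit relative
    compactness, whereas the complement of the union of the \<open>A i\<close> need not have
    it.\<close>
  define \<D> where "\<D> = atom ` (\<Union>i<n. A i)"
  have "finite (range type)"
    by (rule finite_subset[of _ "Pow {..<n}"]) (auto simp: type_def)
  then have "finite ((\<lambda>t. {y. type y = t}) ` range type)"
    by simp
  then have fin: "finite \<D>"
    by (rule finite_subset[rotated]) (auto simp: \<D>_def atom_def)
  obtain D where D: "bij_betw D {..<card \<D>} \<D>"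
    using ex_bij_betw_nat_finite[OF fin] by (auto simp: atLeast0LessThan)
  have borel: "atom x \<in> sets borel" for x
  proof -
    have "atom x = {y \<in> space borel. \<forall>i\<in>{..<n}. y \<in> A i \<longleftrightarrow> x \<in> A i}"
      by (auto simp: atom_def type_def)
    also have "\<dots> \<in> sets borel"
    proof (intro sets.sets_Collect_finite_All)
      fix i assume "i \<in> {..<n}"
      then have [measurable]: "A i \<in> sets borel"
        using A by (auto simp: rel_compact_borel_def)
      show "{y \<in> space borel. y \<in> A i \<longleftrightarrow> x \<in> A i} \<in> sets borel"
        by measurable
    qed simp
    finally show ?thesis .
  qed
  have atom_sub: "atom x \<subseteq> A i" if "i < n" "x \<in> A i" for x i
    using that by (auto simp: atom_def type_def)
  have self: "x \<in> atom x" for x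
    by (simp add: atom_def)
  show ?thesis
  proof (intro exI conjI allI impI)
    show "D j \<in> rel_compact_borel" if "j < card \<D>" for j
    proof -
      have "D j \<in> \<D>"
        using D that by (auto simp: bij_betw_def)
      then obtain i x where "D j = atom x" "i < n" "x \<in> A i"
        by (auto simp: \<D>_def)
      then show ?thesis
        using rel_compact_borel_subset[OF A borel atom_sub] by metis
    qed
    show "disjoint_family_on D {..<card \<D>}"
      unfolding disjoint_family_on_def
    proof (intro ballI impI)
      fix j k assume jk: "j \<in> {..<card \<D>}" "k \<in> {..<card \<D>}" "j \<noteq> k"
      then have "D j \<noteq> D k"
        using D unfolding bij_betw_def inj_on_def by blast
      moreover have "D j \<in> \<D>" "D k \<in> \<D>"
        using D jk by (auto simp: bij_betw_def)
      ultimately show "D j \<inter> D k = {}"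
        by (auto simp: \<D>_def atom_def)
    qed
    show "A i = (\<Union>j\<in>{j\<in>{..<card \<D>}. D j \<subseteq> A i}. D j)" if "i < n" for i
    proof (intro equalityI subsetI)
      fix x assume x: "x \<in> A i"
      then have "atom x \<in> D ` {..<card \<D>}"
        using D that by (auto simp: bij_betw_def \<D>_def)
      then show "x \<in> (\<Union>j\<in>{j\<in>{..<card \<D>}. D j \<subseteq> A i}. D j)"
        using atom_sub[OF that x] self[of x] by auto
    qed auto
  qed
qed

text \<open>Cylinders form an intersection-stable generator, so agreement on them suffices. After
  refining its sets to disjoint ones, a cylinder splits according to the counts in the refined sets
  into countably many disjoint cylinders, to which \<open>eq\<close> applies.\<close>

lemma config_law_eqI:
  fixes P1 P2 :: "'a::metric_space measure measure"
  assumes P1: "prob_space P1" "sets P1 = sets config_space"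
    and P2: "prob_space P2" "sets P2 = sets config_space"
    and eq: "\<And>n D k. (\<And>i. i < n \<Longrightarrow> D i \<in> rel_compact_borel) \<Longrightarrow> disjoint_family_on D {..<n} \<Longrightarrow>
      emeasure P1 (cylinder n D k) = emeasure P2 (cylinder n D k)"
  shows "P1 = P2"
proof (rule measure_eqI_generator_eq[where \<Omega>=configurations and E=cylinders
      and A="\<lambda>_. configurations"])
  interpret P1: prob_space P1 by fact
  show "emeasure P1 configurations \<noteq> \<infinity>"
    by simp
  have "cylinder 0 A k = configurations" for A :: "nat \<Rightarrow> 'a set" and k
    by (simp add: cylinder_def)
  then show "range (\<lambda>_. configurations) \<subseteq> (cylinders :: 'a measure set set)"
    unfolding cylinders_def by blast
  fix X :: "'a measure set" assume "X \<in> cylinders"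
  then obtain n A k where X: "X = cylinder n A k" and A: "\<forall>i<n. A i \<in> rel_compact_borel"
    by (auto simp: cylinders_def)
  obtain N :: nat and D where D': "\<forall>j<N. D j \<in> rel_compact_borel"
    and disj: "disjoint_family_on D {..<N}"
    and AD': "\<forall>i<n. A i = (\<Union>j\<in>{j\<in>{..<N}. D j \<subseteq> A i}. D j)"
    using disjoint_refinement[OF A] by (elim exE conjE)
  note D = D'[rule_format] and AD = AD'[rule_format]
  define J where "J i = {j\<in>{..<N}. D j \<subseteq> A i}" for i
  have eval: "emeasure \<phi> (A i) = (\<Sum>j\<in>J i. emeasure \<phi> (D j))"
    if "\<phi> \<in> configurations" "i < n" for \<phi> i
  proof -
    have "emeasure \<phi> (A i) = emeasure \<phi> (\<Union>j\<in>J i. D j)"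
      using AD[OF that(2)] by (simp add: J_def)
    also have "\<dots> = (\<Sum>j\<in>J i. emeasure \<phi> (D j))"
    proof (rule sum_emeasure[symmetric])
      show "D ` J i \<subseteq> sets \<phi>"
        using D that(1) by (auto simp: J_def configurations_def rel_compact_borel_def)
      show "disjoint_family_on D (J i)"
        using disj by (rule disjoint_family_on_mono[rotated, of _ "{..<N}"]) (auto simp: J_def)
    qed (auto simp: J_def)
    finally show ?thesis .
  qed
  \<comment> \<open>The count vectors are extensional: this makes \<open>C\<close> countable, and
    distinct vectors differ at an index below \<open>N\<close>, so their cylinders are
    disjoint.\<close>
  define C where "C = {c \<in> PiE {..<N} (\<lambda>_. UNIV :: nat set). \<forall>i<n. (\<Sum>j\<in>J i. c j) = k i}"
  have Xeq: "X = (\<Union>c\<in>C. cylinder N D c)"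
  proof (intro equalityI subsetI)
    fix \<phi> assume \<phi>: "\<phi> \<in> X"
    then have conf: "\<phi> \<in> configurations"
      by (simp add: X cylinder_def)
    define c where "c = restrict (\<lambda>j. SOME k. emeasure \<phi> (D j) = of_nat k) {..<N}"
    have c: "emeasure \<phi> (D j) = of_nat (c j)" if "j < N" for j
      using configuration_value[OF conf D[OF that]] that
      by (simp add: c_def) (metis (mono_tags, lifting) someI_ex)
    have "of_nat (\<Sum>j\<in>J i. c j) = (of_nat (k i) :: ennreal)" if "i < n" for i
    proof -
      have "of_nat (\<Sum>j\<in>J i. c j) = (\<Sum>j\<in>J i. emeasure \<phi> (D j))"
        using c by (auto simp: J_def intro!: sum.cong)
      also have "\<dots> = of_nat (k i)"
        using eval[OF conf that] \<phi> that by (simp add: X cylinder_def)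
      finally show ?thesis .
    qed
    then have "c \<in> C"
      unfolding of_nat_eq_iff by (auto simp: C_def c_def)
    moreover have "\<phi> \<in> cylinder N D c"
      using conf c by (simp add: cylinder_def)
    ultimately show "\<phi> \<in> (\<Union>c\<in>C. cylinder N D c)"
      by auto
  next
    fix \<phi> assume "\<phi> \<in> (\<Union>c\<in>C. cylinder N D c)"
    then obtain c where c: "c \<in> C" and conf: "\<phi> \<in> configurations"
      and cD: "\<And>j. j < N \<Longrightarrow> emeasure \<phi> (D j) = of_nat (c j)"
      by (auto simp: cylinder_def)
    have "emeasure \<phi> (A i) = of_nat (k i)" if "i < n" for i
    proof -
      have "emeasure \<phi> (A i) = of_nat (\<Sum>j\<in>J i. c j)"
        unfolding eval[OF conf that] using cD by (auto simp: J_def intro!: sum.cong)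
      also have "(\<Sum>j\<in>J i. c j) = k i"
        using c that by (simp add: C_def)
      finally show ?thesis .
    qed
    then show "\<phi> \<in> X"
      using conf by (simp add: X cylinder_def)
  qed
  have count: "countable C"
    by (rule countable_subset[of _ "PiE {..<N} (\<lambda>_. UNIV :: nat set)"])
       (auto simp: C_def intro!: countable_PiE)
  have disjC: "disjoint_family_on (cylinder N D) C"
    unfolding disjoint_family_on_def
  proof (intro ballI impI)
    fix c d assume cd: "c \<in> C" "d \<in> C" "c \<noteq> d"
    then obtain j where "j < N" "c j \<noteq> d j"
      unfolding C_def by (metis (mono_tags, lifting) PiE_ext lessThan_iff mem_Collect_eq)
    then show "cylinder N D c \<inter> cylinder N D d = {}"
      by (auto simp: cylinder_def)
  qed
  have "emeasure P1 X = (\<integral>\<^sup>+c. emeasure P1 (cylinder N D c) \<partial>count_space C)"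
    unfolding Xeq using D
    by (intro emeasure_UN_countable count disjC) (simp add: P1 sets_cylinder)
  also have "\<dots> = (\<integral>\<^sup>+c. emeasure P2 (cylinder N D c) \<partial>count_space C)"
    using eq[OF D disj] by simp
  also have "\<dots> = emeasure P2 X"
    unfolding Xeq using D
    by (intro emeasure_UN_countable[symmetric] count disjC) (simp add: P2 sets_cylinder)
  finally show "emeasure P1 X = emeasure P2 X" .
next
  show "(cylinders :: 'a measure set set) \<subseteq> Pow configurations"
    by (auto simp: cylinders_def cylinder_def)
qed (auto simp: P1 P2 sets_config_space_cylinders Int_stable_cylinders)

section \<open>Quantile coupling on the natural numbers\<close>

text \<open>The tail includes \<open>n\<close>, so P(X > k) appears as
  \<open>upper p (Suc k)\<close>.\<close>

definition upper :: "nat pmf \<Rightarrow> nat \<Rightarrow> real" where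
  "upper p n = measure_pmf.prob p {n..}"

lemma upper_nonneg: "0 \<le> upper p n" and upper_le_1: "upper p n \<le> 1"
  by (simp_all add: upper_def)

lemma upper_0 [simp]: "upper p 0 = 1"
  by (simp add: upper_def)

lemma upper_antimono: "m \<le> n \<Longrightarrow> upper p n \<le> upper p m"
  unfolding upper_def by (intro measure_pmf.finite_measure_mono) auto

lemma upper_Suc: "upper p n = pmf p n + upper p (Suc n)"
proof -
  have "{n} \<union> {Suc n..} = {n..}"
    by auto
  then show ?thesis
    unfolding upper_def using measure_pmf.finite_measure_Union[of "{n}" p "{Suc n..}"]
    by (simp add: measure_pmf_single)
qed

lemma upper_tendsto_0: "upper p \<longlonglongrightarrow> 0"
proof -
  have "(\<lambda>n. measure_pmf.prob p {n..}) \<longlonglongrightarrow> measure_pmf.prob p (\<Inter>n. {n..})"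
    by (rule measure_pmf.finite_Lim_measure_decseq) (auto simp: decseq_def)
  moreover have "(\<Inter>n. {n..}) = ({} :: nat set)"
    using Suc_n_not_le_n by blast
  ultimately show ?thesis
    unfolding upper_def by simp
qed

text \<open>The level \<open>u\<close> is compared with the upper tail, so this is the usual
  quantile at level \<open>1 - u\<close>, decreasing in \<open>u\<close>. A uniform \<open>u\<close>
  and \<open>1 - u\<close> have the same law.\<close>

definition quantile :: "nat pmf \<Rightarrow> real \<Rightarrow> nat" where
  "quantile p u = (LEAST k. upper p (Suc k) \<le> u)"

text \<open>The Galois connection between tail and quantile. Since \<open>u\<close> is positive the
  tail eventually drops below it, so the minimum exists; \<open>u < 1\<close> settles the case
  \<open>n = 0\<close>.\<close>

lemma le_quantile_iff:
  assumes "0 < u" "u < 1"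
  shows "n \<le> quantile p u \<longleftrightarrow> u < upper p n"
proof -
  have "eventually (\<lambda>k. upper p (Suc k) < u) sequentially"
    using order_tendstoD(2)[OF LIMSEQ_Suc[OF upper_tendsto_0] assms(1)] .
  then have "\<exists>k. upper p (Suc k) \<le> u"
    unfolding eventually_sequentially by (meson less_imp_le order_refl)
  then have Q: "upper p (Suc (quantile p u)) \<le> u"
    unfolding quantile_def by (rule LeastI_ex)
  show ?thesis
  proof
    assume n: "n \<le> quantile p u"
    show "u < upper p n"
    proof (cases n)
      case (Suc k)
      then have "\<not> upper p (Suc k) \<le> u"
        using n not_less_Least[of k "\<lambda>k. upper p (Suc k) \<le> u"] by (simp add: quantile_def)
      then show ?thesis
        using Suc by simp
    qed (use assms in simp)
  next
    assume "u < upper p n"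
    then have "upper p (Suc (quantile p u)) < upper p n"
      using Q by simp
    then show "n \<le> quantile p u"
      using upper_antimono[of "Suc (quantile p u)" n p] by (meson not_less not_less_eq_eq)
  qed
qed

lemma borel_measurable_quantile [measurable]: "quantile p \<in> measurable borel (count_space UNIV)"
  unfolding quantile_def by measurable

abbreviation unif :: "real measure" where
  "unif \<equiv> restrict_space lborel {0<..<1}"

lemma prob_space_unif: "prob_space unif"
  by (rule prob_space_restrict_space) auto

lemma sets_unif_less: "{u \<in> space unif. u < t} \<in> sets unif"
proof -
  have "{u \<in> space unif. u < t} = {0<..<1} \<inter> {..<t}"
    by (auto simp: space_restrict_space)
  then show ?thesis
    by (auto simp: sets_restrict_space)
qed

lemma emeasure_unif_less:
  assumes "0 \<le> t" "t \<le> 1"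
  shows "emeasure unif {u \<in> space unif. u < t} = ennreal t"
proof -
  have "{u \<in> space unif. u < t} = {0<..<t}"
    using assms by (auto simp: space_restrict_space)
  then show ?thesis
    using assms by (simp add: emeasure_restrict_space subset_eq)
qed

lemma emeasure_unif_between:
  assumes "0 \<le> s" "s \<le> t" "t \<le> 1"
  shows "emeasure unif {u \<in> space unif. s \<le> u \<and> u < t} = ennreal (t - s)"
proof -
  have eq: "{u \<in> space unif. s \<le> u \<and> u < t}
      = {u \<in> space unif. u < t} - {u \<in> space unif. u < s}"
    by auto
  have "emeasure unif {u \<in> space unif. s \<le> u \<and> u < t}
      = emeasure unif {u \<in> space unif. u < t} - emeasure unif {u \<in> space unif. u < s}"
    unfolding eq
  proof (rule emeasure_Diff)
    show "emeasure unif {u \<in> space unif. u < s} \<noteq> \<infinity>"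
      using assms emeasure_unif_less[of s] by simp
    show "{u \<in> space unif. u < s} \<subseteq> {u \<in> space unif. u < t}"
      using assms(2) by auto
  qed (rule sets_unif_less)+
  also have "\<dots> = ennreal t - ennreal s"
    using assms by (simp only: emeasure_unif_less order_trans[OF assms(1,2)] order_trans[OF assms(2,3)])
  finally show ?thesis
    using assms by (simp add: ennreal_minus)
qed

text \<open>The quantile equals \<open>n\<close> exactly when \<open>u\<close> lies in the interval
  from \<open>upper p (Suc n)\<close> to \<open>upper p n\<close>, whose length is
  \<open>pmf p n\<close>.\<close>

lemma distr_quantile: "distr unif (count_space UNIV) (quantile p) = measure_pmf p"
proof (rule measure_eqI_countable[where A=UNIV])
  fix n :: nat
  have [measurable]: "quantile p \<in> measurable unif (count_space UNIV)"
    by (intro measurable_restrict_space1) simp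
  have "emeasure (distr unif (count_space UNIV) (quantile p)) {n}
      = emeasure unif (quantile p -` {n} \<inter> space unif)"
    by (rule emeasure_distr) auto
  also have "quantile p -` {n} \<inter> space unif
      = {u \<in> space unif. upper p (Suc n) \<le> u \<and> u < upper p n}"
  proof (intro set_eqI)
    fix u :: real
    show "u \<in> quantile p -` {n} \<inter> space unif
        \<longleftrightarrow> u \<in> {u \<in> space unif. upper p (Suc n) \<le> u \<and> u < upper p n}"
      using le_quantile_iff[of u n p] le_quantile_iff[of u "Suc n" p]
      by (auto simp: space_restrict_space)
  qed
  also have "emeasure unif \<dots> = ennreal (upper p n - upper p (Suc n))"
    by (intro emeasure_unif_between upper_nonneg upper_le_1 upper_antimono) simp
  also have "\<dots> = emeasure (measure_pmf p) {n}"
    by (simp add: upper_Suc[of p n] emeasure_pmf_single)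
  finally show "emeasure (distr unif (count_space UNIV) (quantile p)) {n}
      = emeasure (measure_pmf p) {n}" .
qed auto

text \<open>Counting the integers between \<open>a\<close> and \<open>b\<close> turns the distance
  into a sum of indicators, which can be exchanged with an integral.\<close>

lemma abs_diff_eq_suminf:
  fixes a b :: nat
  shows "ennreal \<bar>real a - real b\<bar> = (\<Sum>k. indicator {min a b..<max a b} k)"
proof -
  have "(\<Sum>k. indicator {min a b..<max a b} k :: ennreal)
      = (\<integral>\<^sup>+k. indicator {min a b..<max a b} k \<partial>count_space UNIV)"
    by (rule nn_integral_count_space_nat[symmetric])
  also have "\<dots> = emeasure (count_space UNIV) {min a b..<max a b}"
    by (rule nn_integral_indicator) simp
  also have "\<dots> = ennreal \<bar>real a - real b\<bar>"
    by (cases "a \<le> b") (simp_all add: ennreal_of_nat_eq_real_of_nat of_nat_diff)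
  finally show ?thesis ..
qed

text \<open>The one-dimensional Wasserstein formula. By Tonelli the integral becomes a sum over
  \<open>k\<close> of the measure of those \<open>u\<close> for which \<open>k\<close> separates the
  two quantiles.\<close>

lemma nn_integral_quantile_diff:
  "(\<integral>\<^sup>+u. ennreal \<bar>real (quantile p u) - real (quantile q u)\<bar> \<partial>unif)
    = (\<Sum>k. ennreal \<bar>upper p (Suc k) - upper q (Suc k)\<bar>)"
proof -
  have [measurable]: "quantile p \<in> measurable unif (count_space UNIV)" for p
    by (intro measurable_restrict_space1) simp
  let ?I = "\<lambda>k u. indicator {min (quantile p u) (quantile q u)..<max (quantile p u) (quantile q u)} k"
  have "(\<integral>\<^sup>+u. ennreal \<bar>real (quantile p u) - real (quantile q u)\<bar> \<partial>unif)
      = (\<integral>\<^sup>+u. (\<Sum>k. ?I k u) \<partial>unif)"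
    unfolding abs_diff_eq_suminf ..
  also have "\<dots> = (\<Sum>k. \<integral>\<^sup>+u. ?I k u \<partial>unif)"
  proof (rule nn_integral_suminf)
    fix k
    have "Measurable.pred unif (\<lambda>u. k \<in> {min (quantile p u) (quantile q u)..<max (quantile p u) (quantile q u)})"
      by measurable
    then show "?I k \<in> borel_measurable unif"
      unfolding indicator_def by measurable
  qed
  also have "(\<lambda>k. \<integral>\<^sup>+u. ?I k u \<partial>unif) = (\<lambda>k. ennreal \<bar>upper p (Suc k) - upper q (Suc k)\<bar>)"
  proof
    fix k
    let ?s = "min (upper p (Suc k)) (upper q (Suc k))" and ?t = "max (upper p (Suc k)) (upper q (Suc k))"
    have "(\<integral>\<^sup>+u. ?I k u \<partial>unif) = (\<integral>\<^sup>+u. indicator {u \<in> space unif. ?s \<le> u \<and> u < ?t} u \<partial>unif)"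
    proof (rule nn_integral_cong)
      fix u assume u: "u \<in> space unif"
      \<comment> \<open>Exactly one of the quantiles exceeds \<open>k\<close> if and only if
        \<open>u\<close> lies between the two tails at \<open>Suc k\<close>.\<close>
      then show "?I k u = indicator {u \<in> space unif. ?s \<le> u \<and> u < ?t} u"
        using le_quantile_iff[of u "Suc k" p] le_quantile_iff[of u "Suc k" q]
        by (auto simp: indicator_def space_restrict_space Suc_le_eq)
    qed
    also have "\<dots> = emeasure unif {u \<in> space unif. ?s \<le> u \<and> u < ?t}"
      by (rule nn_integral_indicator) (auto simp: sets_restrict_space_iff space_restrict_space)
    also have "\<dots> = ennreal (?t - ?s)"
      using upper_nonneg upper_le_1 by (intro emeasure_unif_between) (auto simp: min_def max_def)
    also have "?t - ?s = \<bar>upper p (Suc k) - upper q (Suc k)\<bar>"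
      by auto
    finally show "(\<integral>\<^sup>+u. ?I k u \<partial>unif) = ennreal \<bar>upper p (Suc k) - upper q (Suc k)\<bar>" .
  qed
  finally show ?thesis .
qed

section \<open>Tail differences bounded by cross differences of the weights\<close>

lemma suminf_swap:
  fixes f :: "nat \<Rightarrow> nat \<Rightarrow> ennreal"
  shows "(\<Sum>i. \<Sum>j. f i j) = (\<Sum>j. \<Sum>i. f i j)"
  using nn_integral_suminf[of "\<lambda>j i. f i j" "count_space UNIV"]
  by (simp add: nn_integral_count_space_nat)

lemma emeasure_pmf_suminf:
  "emeasure (measure_pmf p) A = (\<Sum>j. ennreal (pmf p j) * of_bool (j \<in> A))" for p :: "nat pmf"
proof -
  have "emeasure (measure_pmf p) A = (\<integral>\<^sup>+j. indicator A j \<partial>measure_pmf p)"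
    by simp
  also have "\<dots> = (\<integral>\<^sup>+j. ennreal (pmf p j) * indicator A j \<partial>count_space UNIV)"
    by (rule nn_integral_measure_pmf)
  finally show ?thesis
    by (simp add: nn_integral_count_space_nat indicator_def)
qed

lemma upper_suminf: "ennreal (upper p k) = (\<Sum>j. ennreal (pmf p j) * of_bool (k \<le> j))"
  using emeasure_pmf_suminf[of p "{k..}"]
  by (simp add: upper_def measure_pmf.emeasure_eq_measure)

lemma lower_suminf: "ennreal (1 - upper p k) = (\<Sum>j. ennreal (pmf p j) * of_bool (j < k))"
proof -
  have "UNIV - {k..} = {..<k}"
    by auto
  then have "1 - upper p k = measure_pmf.prob p {..<k}"
    unfolding upper_def using measure_pmf.prob_compl[of "{k..}" p] by simp
  then show ?thesis
    using emeasure_pmf_suminf[of p "{..<k}"]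
    by (simp add: measure_pmf.emeasure_eq_measure)
qed

text \<open>With tails a and b, a - b = a (1 - b) - b (1 - a), and both products expand into double
  sums over \<open>i < k\<close> and \<open>k \<le> j\<close>. The comparison is made additively,
  since subtraction in \<open>ennreal\<close> is truncated.\<close>

lemma upper_diff_le:
  "ennreal (upper p k - upper q k)
    \<le> (\<Sum>i. \<Sum>j. ennreal \<bar>pmf p j * pmf q i - pmf p i * pmf q j\<bar> * of_bool (i < k \<and> k \<le> j))"
  (is "_ \<le> ?S")
proof -
  have product: "ennreal (upper p k * (1 - upper q k))
      = (\<Sum>i. \<Sum>j. ennreal (pmf p j * pmf q i) * of_bool (i < k \<and> k \<le> j))" for p q
  proof -
    have "ennreal (upper p k * (1 - upper q k))
        = (\<Sum>i. (ennreal (pmf q i) * of_bool (i < k)) * ennreal (upper p k))"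
      by (simp add: ennreal_mult' upper_le_1 upper_nonneg lower_suminf[symmetric] mult.commute)
    also have "\<dots> = (\<Sum>i. \<Sum>j. (ennreal (pmf q i) * of_bool (i < k)) * (ennreal (pmf p j) * of_bool (k \<le> j)))"
      unfolding upper_suminf by simp
    also have "\<dots> = (\<Sum>i. \<Sum>j. ennreal (pmf p j * pmf q i) * of_bool (i < k \<and> k \<le> j))"
      by (intro suminf_cong) (simp add: ennreal_mult' ac_simps)
    finally show ?thesis .
  qed
  have "ennreal (upper p k * (1 - upper q k))
      \<le> (\<Sum>i. \<Sum>j. ennreal (pmf q j * pmf p i) * of_bool (i < k \<and> k \<le> j)
          + ennreal \<bar>pmf p j * pmf q i - pmf p i * pmf q j\<bar> * of_bool (i < k \<and> k \<le> j))"
    unfolding product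
  proof (intro suminf_le allI)
    fix i j
    have "ennreal (pmf p j * pmf q i)
        \<le> ennreal (pmf q j * pmf p i + \<bar>pmf p j * pmf q i - pmf p i * pmf q j\<bar>)"
      by (intro ennreal_leI) (simp add: mult.commute)
    then show "ennreal (pmf p j * pmf q i) * of_bool (i < k \<and> k \<le> j)
      \<le> ennreal (pmf q j * pmf p i) * of_bool (i < k \<and> k \<le> j)
          + ennreal \<bar>pmf p j * pmf q i - pmf p i * pmf q j\<bar> * of_bool (i < k \<and> k \<le> j)"
      by (cases "i < k \<and> k \<le> j") auto
  qed auto
  also have "\<dots> = ennreal (upper q k * (1 - upper p k)) + ?S"
    unfolding product by (simp add: suminf_add)
  finally have le: "ennreal (upper p k * (1 - upper q k)) \<le> ennreal (upper q k * (1 - upper p k)) + ?S" .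
  show ?thesis
  \<comment> \<open>If the double sum is infinite nothing is to be shown; otherwise the inequality
    is one of reals and the products of tails cancel.\<close>
  proof (cases ?S)
    case (real s)
    then have "ennreal (upper p k * (1 - upper q k)) \<le> ennreal (upper q k * (1 - upper p k) + s)"
      using le upper_nonneg[of q k] upper_le_1[of p k] by simp
    then have "upper p k * (1 - upper q k) \<le> upper q k * (1 - upper p k) + s"
      using real upper_nonneg[of q k] upper_le_1[of p k] by (subst (asm) ennreal_le_iff) auto
    then show ?thesis
      using real by (simp add: algebra_simps)
  qed simp
qed

lemma abs_upper_diff_le:
  "ennreal \<bar>upper p k - upper q k\<bar>
    \<le> (\<Sum>i. \<Sum>j. ennreal \<bar>pmf p j * pmf q i - pmf p i * pmf q j\<bar> * of_bool (i < k \<and> k \<le> j))"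
proof (cases "upper p k \<le> upper q k")
  case True
  then show ?thesis
    using upper_diff_le[of q k p] by (simp add: abs_minus_commute mult.commute)
next
  case False
  then show ?thesis
    using upper_diff_le[of p k q] by simp
qed

lemma suminf_of_bool_between: "(\<Sum>k. of_bool (i \<le> k \<and> k < j)) = (of_nat (j - i) :: ennreal)"
proof -
  have "(\<Sum>k. of_bool (i \<le> k \<and> k < j) :: ennreal) = (\<Sum>k\<in>{i..<j}. of_bool (i \<le> k \<and> k < j))"
    by (rule suminf_finite) auto
  also have "\<dots> = of_nat (j - i)"
    by simp
  finally show ?thesis .
qed

text \<open>A pair \<open>i < j\<close> contributes to the tail difference for each \<open>k\<close>
  with \<open>i \<le> k < j\<close>, that is \<open>j - i\<close> times. For
  \<open>j \<le> i\<close> the truncated difference is 0.\<close>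

lemma suminf_abs_upper_diff_le:
  "(\<Sum>k. ennreal \<bar>upper p (Suc k) - upper q (Suc k)\<bar>)
    \<le> (\<Sum>i. \<Sum>j. ennreal \<bar>pmf p j * pmf q i - pmf p i * pmf q j\<bar> * of_nat (j - i))"
proof -
  let ?w = "\<lambda>i j. ennreal \<bar>pmf p j * pmf q i - pmf p i * pmf q j\<bar>"
  have "(\<Sum>k. ennreal \<bar>upper p (Suc k) - upper q (Suc k)\<bar>)
      \<le> (\<Sum>k. \<Sum>i. \<Sum>j. ?w i j * of_bool (i \<le> k \<and> k < j))"
    using abs_upper_diff_le[of p "Suc _" q] by (intro suminf_le) (auto simp: less_Suc_eq_le Suc_le_eq)
  also have "\<dots> = (\<Sum>i. \<Sum>k. \<Sum>j. ?w i j * of_bool (i \<le> k \<and> k < j))"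
    by (rule suminf_swap)
  also have "\<dots> = (\<Sum>i. \<Sum>j. \<Sum>k. ?w i j * of_bool (i \<le> k \<and> k < j))"
    by (subst suminf_swap) simp
  also have "\<dots> = (\<Sum>i. \<Sum>j. ?w i j * of_nat (j - i))"
    by (simp add: suminf_of_bool_between)
  finally show ?thesis .
qed

section \<open>The Stein kernel of the Poisson distribution\<close>

lemma poisson_pmf_Suc:
  assumes "0 < r"
  shows "real (Suc n) * pmf (poisson_pmf r) (Suc n) = r * pmf (poisson_pmf r) n"
  using assms by (simp add: field_simps del: of_nat_Suc)

lemma sum_pmf_atMost: "(\<Sum>i\<le>n. pmf q i) = 1 - upper q (Suc n)"
proof (induction n)
  case 0
  then show ?case
    using upper_Suc[of q 0] by simp
next
  case (Suc n)
  then show ?case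
    using upper_Suc[of q "Suc n"] by simp
qed

text \<open>Stein's identity E(X f(X)) = r E(f(X + 1)) for the indicator f of X \<le> n. The
  right-hand side is r P(X \<le> n - 1), written so that it also covers
  \<open>n = 0\<close>.\<close>

lemma sum_index_poisson_pmf_atMost:
  assumes "0 < r"
  shows "(\<Sum>i\<le>n. real i * pmf (poisson_pmf r) i)
    = r * ((\<Sum>i\<le>n. pmf (poisson_pmf r) i) - pmf (poisson_pmf r) n)"
proof (induction n)
  case (Suc n)
  have "(\<Sum>i\<le>Suc n. real i * pmf (poisson_pmf r) i)
      = r * ((\<Sum>i\<le>n. pmf (poisson_pmf r) i) - pmf (poisson_pmf r) n) + r * pmf (poisson_pmf r) n"
    using Suc poisson_pmf_Suc[OF assms, of n] by (simp del: of_nat_Suc pmf_poisson)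
  then show ?case
    by (simp add: algebra_simps del: pmf_poisson)
qed simp

text \<open>Stein's identity for the indicator of X > n; the shift by one turns this condition into
  X \<ge> n, hence the tail at \<open>n\<close> and not at \<open>Suc n\<close>.\<close>

lemma suminf_index_poisson_pmf_upper:
  assumes r: "0 < r"
  shows "(\<Sum>j. ennreal (pmf (poisson_pmf r) j) * of_nat j * of_bool (n < j))
    = ennreal (r * upper (poisson_pmf r) n)"
proof -
  let ?f = "\<lambda>j. ennreal (pmf (poisson_pmf r) j) * of_nat j * of_bool (n < j)"
  \<comment> \<open>The term at index 0 vanishes because of the factor \<open>of_nat j\<close>, so
    the sum may be reindexed before applying the recursion of the weights.\<close>
  have "(\<lambda>j. ?f (Suc j)) sums (\<Sum>j. ?f (Suc j))"
    by (simp add: summable_sums del: pmf_poisson)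
  then have "?f sums ((\<Sum>j. ?f (Suc j)) + ?f 0)"
    by (rule sums_Suc)
  then have "(\<Sum>j. ?f j) = (\<Sum>j. ?f (Suc j))"
    by (simp add: sums_iff)
  also have "\<dots> = (\<Sum>j. ennreal r * (ennreal (pmf (poisson_pmf r) j) * of_bool (n \<le> j)))"
  proof (intro suminf_cong)
    fix j
    have "ennreal (pmf (poisson_pmf r) (Suc j)) * of_nat (Suc j) = ennreal (real (Suc j) * pmf (poisson_pmf r) (Suc j))"
      by (simp add: ennreal_of_nat_eq_real_of_nat ennreal_mult'' mult.commute del: pmf_poisson of_nat_Suc)
    also have "\<dots> = ennreal r * ennreal (pmf (poisson_pmf r) j)"
      unfolding poisson_pmf_Suc[OF r] using r by (simp add: ennreal_mult' del: pmf_poisson)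
    finally show "?f (Suc j) = ennreal r * (ennreal (pmf (poisson_pmf r) j) * of_bool (n \<le> j))"
      by (simp add: less_Suc_eq_le mult.assoc del: pmf_poisson of_nat_Suc)
  qed
  also have "\<dots> = ennreal (r * upper (poisson_pmf r) n)"
    using r by (simp add: upper_suminf[symmetric] ennreal_mult' del: pmf_poisson)
  finally show ?thesis .
qed

text \<open>For Y Poisson, this evaluates E((Y - i) 1(Y > n)); as \<open>i \<le> n < j\<close>, the
  subtraction \<open>j - i\<close> is not truncated. The first claim records that the difference
  inside \<open>ennreal\<close> is nonnegative.\<close>

lemma suminf_diff_poisson_pmf_upper:
  assumes r: "0 < r" and i: "i \<le> n"
  defines "q \<equiv> poisson_pmf r"
  shows "real i * upper q (Suc n) \<le> r * upper q n"
    and "(\<Sum>j. ennreal (pmf q j) * of_nat (j - i) * of_bool (n < j))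
      = ennreal (r * upper q n - real i * upper q (Suc n))"
proof -
  let ?A = "\<Sum>j. ennreal (pmf q j) * of_nat (j - i) * of_bool (n < j)"
  have "ennreal (r * upper q n) = (\<Sum>j. ennreal (pmf q j) * of_nat j * of_bool (n < j))"
    unfolding q_def suminf_index_poisson_pmf_upper[OF r] ..
  also have "\<dots> = (\<Sum>j. ennreal (pmf q j) * of_nat (j - i) * of_bool (n < j)
      + of_nat i * (ennreal (pmf q j) * of_bool (Suc n \<le> j)))"
  proof (intro suminf_cong)
    fix j
    show "ennreal (pmf q j) * of_nat j * of_bool (n < j)
      = ennreal (pmf q j) * of_nat (j - i) * of_bool (n < j)
        + of_nat i * (ennreal (pmf q j) * of_bool (Suc n \<le> j))"
    proof (cases "n < j")
      case True
      then have "of_nat j = (of_nat (j - i) + of_nat i :: ennreal)"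
        using i by (simp flip: of_nat_add)
      then show ?thesis
        using True by (simp add: distrib_left mult.commute Suc_le_eq)
    qed auto
  qed
  also have "\<dots> = ?A + of_nat i * ennreal (upper q (Suc n))"
    by (simp add: suminf_add[symmetric] upper_suminf)
  also have "\<dots> = ?A + ennreal (real i * upper q (Suc n))"
    by (simp add: ennreal_of_nat_eq_real_of_nat ennreal_mult')
  finally have eq: "ennreal (r * upper q n) = ?A + ennreal (real i * upper q (Suc n))" .
  then have "ennreal (real i * upper q (Suc n)) \<le> ennreal (r * upper q n)"
    by simp
  then show "real i * upper q (Suc n) \<le> r * upper q n"
    using r by (simp add: upper_nonneg)
  have "?A = ennreal (r * upper q n) - ennreal (real i * upper q (Suc n))"
    unfolding eq by (simp add: ennreal_add_diff_cancel_right)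
  then show "?A = ennreal (r * upper q n - real i * upper q (Suc n))"
    by (simp add: ennreal_minus upper_nonneg)
qed

text \<open>For \<open>X\<close>, \<open>Y\<close> independent Poisson variables of mean \<open>r\<close> this is \<open>E((Y - X) 1(X \<le> n < Y)) =
  Cov(X, 1(X > n))\<close>, which the Stein identity \<open>E(X f(X)) = r E(f(X + 1))\<close> evaluates to \<open>r P(X = n)\<close>.\<close>

lemma poisson_kernel:
  assumes r: "0 < r"
  defines "q \<equiv> poisson_pmf r"
  shows "(\<Sum>i. \<Sum>j. ennreal (pmf q i * pmf q j) * of_nat (j - i) * of_bool (i \<le> n \<and> n < j))
    = ennreal (r * pmf q n)"
proof -
  \<comment> \<open>\<open>?t i\<close> is the inner expectation E((Y - i) 1(Y > n)).\<close>
  let ?t = "\<lambda>i. r * upper q n - real i * upper q (Suc n)"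
  have t: "0 \<le> ?t i" if "i \<le> n" for i
    using suminf_diff_poisson_pmf_upper(1)[OF r that] by (simp add: q_def)
  have "(\<Sum>i. \<Sum>j. ennreal (pmf q i * pmf q j) * of_nat (j - i) * of_bool (i \<le> n \<and> n < j))
      = (\<Sum>i. of_bool (i \<le> n) * ennreal (pmf q i * ?t i))"
  proof (intro suminf_cong)
    fix i
    show "(\<Sum>j. ennreal (pmf q i * pmf q j) * of_nat (j - i) * of_bool (i \<le> n \<and> n < j))
      = of_bool (i \<le> n) * ennreal (pmf q i * ?t i)"
    proof (cases "i \<le> n")
      case True
      then have "(\<Sum>j. ennreal (pmf q i * pmf q j) * of_nat (j - i) * of_bool (i \<le> n \<and> n < j))
          = (\<Sum>j. ennreal (pmf q i) * (ennreal (pmf q j) * of_nat (j - i) * of_bool (n < j)))"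
        by (simp add: ennreal_mult' mult.assoc)
      also have "\<dots> = ennreal (pmf q i) * ennreal (?t i)"
        using suminf_diff_poisson_pmf_upper(2)[OF r True] by (simp add: q_def del: pmf_poisson)
      finally show ?thesis
        using True t[OF True] by (simp add: ennreal_mult')
    qed simp
  qed
  also have "\<dots> = (\<Sum>i\<le>n. of_bool (i \<le> n) * ennreal (pmf q i * ?t i))"
    by (rule suminf_finite) auto
  also have "\<dots> = ennreal (\<Sum>i\<le>n. pmf q i * ?t i)"
    by (subst sum_ennreal[symmetric]) (use t in auto)
  also have "(\<Sum>i\<le>n. pmf q i * ?t i)
      = r * upper q n * (\<Sum>i\<le>n. pmf q i) - upper q (Suc n) * (\<Sum>i\<le>n. real i * pmf q i)"
    by (simp add: algebra_simps sum_subtractf sum_distrib_left)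
  \<comment> \<open>With U the tail at \<open>Suc n\<close> and q the weight at \<open>n\<close>,
    this is r (q + U) (1 - U) - r U (1 - U - q) = r q.\<close>
  also have "\<dots> = r * pmf q n"
    unfolding sum_index_poisson_pmf_atMost[OF r, folded q_def] sum_pmf_atMost upper_Suc[of q n]
    by (simp add: algebra_simps)
  finally show ?thesis .
qed

text \<open>Divided by \<open>pmf q i * pmf q j\<close>, the cross difference becomes the difference
  of the likelihood ratios \<open>\<rho> n = pmf p n / pmf q n\<close> at \<open>j\<close> and
  \<open>i\<close>, which telescopes.\<close>

lemma pmf_cross_diff_le:
  fixes p :: "nat pmf"
  assumes r: "0 < r" and ij: "i \<le> j"
  defines "q \<equiv> poisson_pmf r"
  shows "\<bar>pmf p j * pmf q i - pmf p i * pmf q j\<bar>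
    \<le> pmf q i * pmf q j * (\<Sum>n=i..<j. \<bar>real (n + 1) * pmf p (n + 1) - r * pmf p n\<bar> / (r * pmf q n))"
proof -
  define \<rho> where "\<rho> n = pmf p n / pmf q n" for n
  have q: "0 < pmf q n" for n
    using r by (simp add: q_def)
  have incr: "\<rho> (Suc n) - \<rho> n = (real (n + 1) * pmf p (n + 1) - r * pmf p n) / (r * pmf q n)" for n
  proof -
    have q_Suc: "pmf q (Suc n) = r * pmf q n / real (Suc n)"
      using poisson_pmf_Suc[OF r, of n, folded q_def] by (simp add: field_simps del: of_nat_Suc)
    have "\<rho> (Suc n) = real (Suc n) * pmf p (Suc n) / (r * pmf q n)"
      unfolding \<rho>_def q_Suc by simp
    moreover have "\<rho> n = r * pmf p n / (r * pmf q n)"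
      using r by (simp add: \<rho>_def)
    ultimately show ?thesis
      by (simp add: diff_divide_distrib)
  qed
  have "pmf p j * pmf q i - pmf p i * pmf q j = pmf q i * pmf q j * (\<rho> j - \<rho> i)"
    using q[of i] q[of j] by (simp add: \<rho>_def field_simps)
  also have "\<rho> j - \<rho> i = (\<Sum>n=i..<j. \<rho> (Suc n) - \<rho> n)"
    using ij by (simp add: sum_Suc_diff')
  finally have "\<bar>pmf p j * pmf q i - pmf p i * pmf q j\<bar> = pmf q i * pmf q j * \<bar>\<Sum>n=i..<j. \<rho> (Suc n) - \<rho> n\<bar>"
    by (simp add: abs_mult)
  also have "\<dots> \<le> pmf q i * pmf q j * (\<Sum>n=i..<j. \<bar>\<rho> (Suc n) - \<rho> n\<bar>)"
    by (intro mult_left_mono sum_abs) simp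
  finally show ?thesis
    unfolding incr using r q by (simp add: abs_divide abs_mult)
qed

text \<open>The cross differences are expanded into increments of the likelihood ratio. Moving the
  sum over these increments outermost leaves the Poisson kernel inside.\<close>

lemma poisson_transport_bound:
  fixes p :: "nat pmf"
  assumes r: "0 < r"
  shows "(\<Sum>k. ennreal \<bar>upper p (Suc k) - upper (poisson_pmf r) (Suc k)\<bar>)
    \<le> (\<Sum>n. ennreal \<bar>real (n + 1) * pmf p (n + 1) - r * pmf p n\<bar>)"
proof -
  define q where "q = poisson_pmf r"
  define d where "d n = \<bar>real (n + 1) * pmf p (n + 1) - r * pmf p n\<bar>" for n
  \<comment> \<open>The absolute increment of the likelihood ratio; its denominator is the value of
    the kernel sum at \<open>n\<close>.\<close>
  define c where "c n = d n / (r * pmf q n)" for n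
  have q: "0 < pmf q n" for n
    using r by (simp add: q_def)
  have c: "0 \<le> c n" for n
    using r q[of n] by (simp add: c_def d_def)
  let ?k = "\<lambda>i j n. ennreal (pmf q i * pmf q j) * of_nat (j - i) * of_bool (i \<le> n \<and> n < j)"
  have "(\<Sum>k. ennreal \<bar>upper p (Suc k) - upper q (Suc k)\<bar>)
      \<le> (\<Sum>i. \<Sum>j. ennreal \<bar>pmf p j * pmf q i - pmf p i * pmf q j\<bar> * of_nat (j - i))"
    by (rule suminf_abs_upper_diff_le)
  also have "\<dots> \<le> (\<Sum>i. \<Sum>j. \<Sum>n. ennreal (c n) * ?k i j n)"
  proof (intro suminf_le allI)
    fix i j
    show "ennreal \<bar>pmf p j * pmf q i - pmf p i * pmf q j\<bar> * of_nat (j - i)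
        \<le> (\<Sum>n. ennreal (c n) * ?k i j n)"
    \<comment> \<open>For \<open>i > j\<close> the left side is 0, since \<open>j - i\<close> is
      truncated.\<close>
    proof (cases "i \<le> j")
      case True
      have "ennreal \<bar>pmf p j * pmf q i - pmf p i * pmf q j\<bar> * of_nat (j - i)
          \<le> ennreal (pmf q i * pmf q j * (\<Sum>n=i..<j. c n)) * of_nat (j - i)"
        using pmf_cross_diff_le[OF r True, of p, folded q_def]
        by (intro mult_right_mono ennreal_leI) (simp_all add: c_def d_def)
      also have "\<dots> = ennreal (pmf q i * pmf q j) * of_nat (j - i) * ennreal (\<Sum>n=i..<j. c n)"
        by (simp add: ennreal_mult' ac_simps)
      also have "ennreal (\<Sum>n=i..<j. c n) = (\<Sum>n=i..<j. ennreal (c n) * of_bool (i \<le> n \<and> n < j))"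
        using c by (simp add: sum_ennreal)
      also have "\<dots> = (\<Sum>n. ennreal (c n) * of_bool (i \<le> n \<and> n < j))"
        by (rule suminf_finite[symmetric]) auto
      also have "ennreal (pmf q i * pmf q j) * of_nat (j - i) * \<dots> = (\<Sum>n. ennreal (c n) * ?k i j n)"
        by (simp add: ac_simps flip: ennreal_suminf_cmult)
      finally show ?thesis .
    qed simp
  qed auto
  also have "\<dots> = (\<Sum>i. \<Sum>n. \<Sum>j. ennreal (c n) * ?k i j n)"
    by (subst suminf_swap) simp
  also have "\<dots> = (\<Sum>n. \<Sum>i. \<Sum>j. ennreal (c n) * ?k i j n)"
    by (rule suminf_swap)
  also have "\<dots> = (\<Sum>n. ennreal (c n) * ennreal (r * pmf q n))"
    using poisson_kernel[OF r, folded q_def] by simp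
  also have "\<dots> = (\<Sum>n. ennreal (d n))"
  proof (intro suminf_cong)
    fix n
    show "ennreal (c n) * ennreal (r * pmf q n) = ennreal (d n)"
      using r q[of n] c[of n] by (simp add: c_def flip: ennreal_mult)
  qed
  finally show ?thesis
    by (simp add: q_def d_def)
qed

section \<open>Poissonized multinomial counts\<close>

text \<open>Arbitrary functions are allowed, not only points of a product space, so that updating
  one coordinate needs no side conditions; the event is intersected with the space where it is
  measured.\<close>

definition count_event :: "nat \<Rightarrow> (nat \<Rightarrow> 'a set) \<Rightarrow> (nat \<Rightarrow> nat) \<Rightarrow> nat \<Rightarrow> (nat \<Rightarrow> 'a) set" where
  "count_event n D k m = {x. \<forall>j<n. card {i. i < m \<and> x i \<in> D j} = k j}"

text \<open>The last point either misses all \<open>D j\<close> or lies in exactly one, in which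
  case the first \<open>m\<close> points must supply one point fewer there. The factor
  \<open>of_bool (0 < k j)\<close> excludes the truncated case \<open>k j = 0\<close>.\<close>

lemma count_event_upd:
  assumes D: "disjoint_family_on D {..<n}"
  shows "indicator (count_event n D k (Suc m)) (x(m := y))
    = (indicator (- (\<Union>j<n. D j)) y * indicator (count_event n D k m) x
      + (\<Sum>j<n. indicator (D j) y * (of_bool (0 < k j) * indicator (count_event n D (k(j := k j - 1)) m) x)) :: ennreal)"
proof -
  have card: "card {i. i < Suc m \<and> (x(m := y)) i \<in> E} = card {i. i < m \<and> x i \<in> E} + of_bool (y \<in> E)" for E
  proof -
    have "{i. i < Suc m \<and> (x(m := y)) i \<in> E} = {i. i < m \<and> x i \<in> E} \<union> (if y \<in> E then {m} else {})"
      by (auto simp: less_Suc_eq)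
    also have "card \<dots> = card {i. i < m \<and> x i \<in> E} + of_bool (y \<in> E)"
      by (subst card_Un_disjoint) auto
    finally show ?thesis .
  qed
  show ?thesis
  proof (cases "\<exists>j<n. y \<in> D j")
    case False
    then have "x(m := y) \<in> count_event n D k (Suc m) \<longleftrightarrow> x \<in> count_event n D k m"
      unfolding count_event_def mem_Collect_eq card by auto
    moreover have "(\<Sum>j<n. indicator (D j) y * (of_bool (0 < k j) * indicator (count_event n D (k(j := k j - 1)) m) x)) = (0 :: ennreal)"
      using False by (intro sum.neutral) auto
    ultimately show ?thesis
      using False by (simp add: indicator_def)
  next
    case True
    then obtain j where j: "j < n" "y \<in> D j"
      by auto
    have notin: "y \<notin> D l" if "l < n" "l \<noteq> j" for l
      using D j that by (auto simp: disjoint_family_on_def)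
    have iff: "y \<in> D l \<longleftrightarrow> l = j" if "l < n" for l
      using j notin that by blast
    have eqv: "x(m := y) \<in> count_event n D k (Suc m) \<longleftrightarrow> 0 < k j \<and> x \<in> count_event n D (k(j := k j - 1)) m"
    proof -
      have "x(m := y) \<in> count_event n D k (Suc m)
          \<longleftrightarrow> (\<forall>l<n. card {i. i < m \<and> x i \<in> D l} + of_bool (l = j) = k l)"
        unfolding count_event_def mem_Collect_eq card by (rule all_cong) (simp add: iff)
      also have "\<dots> \<longleftrightarrow> 0 < k j \<and> (\<forall>l<n. card {i. i < m \<and> x i \<in> D l} = (k(j := k j - 1)) l)"
        using j(1) by (auto split: if_splits)
      finally show ?thesis
        by (simp add: count_event_def)
    qed
    have "(\<Sum>l<n. indicator (D l) y * (of_bool (0 < k l) * indicator (count_event n D (k(l := k l - 1)) m) x))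
        = (\<Sum>l<n. if l = j then of_bool (0 < k j) * indicator (count_event n D (k(j := k j - 1)) m) x else 0 :: ennreal)"
      using j notin by (intro sum.cong) auto
    also have "\<dots> = of_bool (0 < k j) * indicator (count_event n D (k(j := k j - 1)) m) x"
      using j(1) by simp
    finally show ?thesis
      using eqv j by (auto simp: indicator_def)
  qed
qed

lemma count_event_measurable:
  assumes D: "\<forall>j<n. D j \<in> sets \<mu>"
  shows "count_event n D k m \<inter> space (Pi\<^sub>M {..<m} (\<lambda>_. \<mu>)) \<in> sets (Pi\<^sub>M {..<m} (\<lambda>_. \<mu>))"
proof -
  let ?P = "Pi\<^sub>M {..<m} (\<lambda>_. \<mu>)"
  have "count_event n D k m \<inter> space ?P
      = {x \<in> space ?P. \<forall>j\<in>{..<n}. (\<Sum>i<m. indicator (D j) (x i)) = real (k j)}"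
  proof -
    have "(\<Sum>i<m. indicator (D j) (x i)) = real (card {i. i < m \<and> x i \<in> D j})" for j and x :: "nat \<Rightarrow> 'a"
      by (simp add: indicator_def sum.If_cases Int_def)
    then show ?thesis
      by (auto simp: count_event_def)
  qed
  also have "\<dots> \<in> sets ?P"
  proof (intro sets.sets_Collect_finite_All)
    fix j assume "j \<in> {..<n}"
    then have [measurable]: "D j \<in> sets \<mu>"
      using D by simp
    have [measurable]: "(\<lambda>x. indicator (D j) (x i) :: real) \<in> borel_measurable ?P" if "i \<in> {..<m}" for i
      using that by measurable
    show "{x \<in> space ?P. (\<Sum>i<m. indicator (D j) (x i)) = real (k j)} \<in> sets ?P"
      by measurable
  qed simp
  finally show ?thesis .
qed

text \<open>The decomposition by the position of the last point is integrated over that coordinate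
  by Fubini, giving a recursion in the number of points.\<close>

lemma count_event_Suc:
  assumes \<mu>: "prob_space \<mu>" and D: "\<forall>j<n. D j \<in> sets \<mu>"
    and disj: "disjoint_family_on D {..<n}"
  defines "e \<equiv> \<lambda>k m. emeasure (Pi\<^sub>M {..<m} (\<lambda>_. \<mu>)) (count_event n D k m \<inter> space (Pi\<^sub>M {..<m} (\<lambda>_. \<mu>)))"
  shows "e k (Suc m) = emeasure \<mu> (space \<mu> - (\<Union>j<n. D j)) * e k m
    + (\<Sum>j<n. emeasure \<mu> (D j) * (of_bool (0 < k j) * e (k(j := k j - 1)) m))"
proof -
  interpret \<mu>: prob_space \<mu> by fact
  interpret P: product_sigma_finite "\<lambda>_. \<mu>" ..
  let ?P = "\<lambda>m. Pi\<^sub>M {..<m} (\<lambda>_. \<mu>)"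
  let ?E = "\<lambda>k m. count_event n D k m \<inter> space (?P m)"
  let ?R = "space \<mu> - (\<Union>j<n. D j)"
  have R: "?R \<in> sets \<mu>"
    using D by auto
  have E [measurable]: "?E k m \<in> sets (?P m)" for k m
    using D by (rule count_event_measurable)
  have E' [measurable]: "indicator (?E k m) \<in> borel_measurable (?P m)" for k m
    using E by simp
  have integral: "(\<integral>\<^sup>+y. indicator R y * a + (\<Sum>j<n. indicator (D j) y * b j) \<partial>\<mu>)
      = emeasure \<mu> R * a + (\<Sum>j<n. emeasure \<mu> (D j) * b j)"
    if R [measurable]: "R \<in> sets \<mu>" for R a and b :: "nat \<Rightarrow> ennreal"
  proof -
    have m: "(\<lambda>y. indicator (D j) y * b j) \<in> borel_measurable \<mu>" if "j \<in> {..<n}" for j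
    proof -
      have [measurable]: "D j \<in> sets \<mu>"
        using D that by simp
      show ?thesis
        by measurable
    qed
    have "(\<lambda>y. indicator R y * a) \<in> borel_measurable \<mu>"
      by measurable
    then have "(\<integral>\<^sup>+y. indicator R y * a + (\<Sum>j<n. indicator (D j) y * b j) \<partial>\<mu>)
        = (\<integral>\<^sup>+y. indicator R y * a \<partial>\<mu>) + (\<integral>\<^sup>+y. (\<Sum>j<n. indicator (D j) y * b j) \<partial>\<mu>)"
      by (rule nn_integral_add) (intro borel_measurable_sum m)
    also have "(\<integral>\<^sup>+y. (\<Sum>j<n. indicator (D j) y * b j) \<partial>\<mu>) = (\<Sum>j<n. \<integral>\<^sup>+y. indicator (D j) y * b j \<partial>\<mu>)"
      by (rule nn_integral_sum) (rule m)
    also have "\<dots> = (\<Sum>j<n. emeasure \<mu> (D j) * b j)"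
      using D by (intro sum.cong) (auto simp: nn_integral_multc)
    finally show ?thesis
      using R by (simp add: nn_integral_multc)
  qed
  have ins: "insert m {..<m} = {..<Suc m}"
    by auto
  have "e k (Suc m) = (\<integral>\<^sup>+x. indicator (?E k (Suc m)) x \<partial>?P (Suc m))"
    by (simp add: e_def E del: Int_iff)
  also have "\<dots> = (\<integral>\<^sup>+x. \<integral>\<^sup>+y. indicator (?E k (Suc m)) (x(m := y)) \<partial>\<mu> \<partial>?P m)"
    using P.product_nn_integral_insert[of "{..<m}" m "indicator (?E k (Suc m))"] E'[of k "Suc m"]
    by (simp add: ins del: Int_iff)
  also have "\<dots> = (\<integral>\<^sup>+x. \<integral>\<^sup>+y. indicator ?R y * indicator (?E k m) x
      + (\<Sum>j<n. indicator (D j) y * (of_bool (0 < k j) * indicator (?E (k(j := k j - 1)) m) x)) \<partial>\<mu> \<partial>?P m)"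
  proof (intro nn_integral_cong)
    fix x y assume x: "x \<in> space (?P m)" and y: "y \<in> space \<mu>"
    have up: "x(m := y) \<in> space (?P (Suc m))"
      using x y by (auto simp: space_PiM PiE_def extensional_def Pi_def less_Suc_eq)
    have "indicator (?E k (Suc m)) (x(m := y)) = (indicator (count_event n D k (Suc m)) (x(m := y)) :: ennreal)"
      using up by (simp add: indicator_def)
    also have "\<dots> = indicator ?R y * indicator (?E k m) x
      + (\<Sum>j<n. indicator (D j) y * (of_bool (0 < k j) * indicator (?E (k(j := k j - 1)) m) x))"
      unfolding count_event_upd[OF disj] using x y by (simp add: indicator_def)
    finally show "indicator (?E k (Suc m)) (x(m := y)) = indicator ?R y * indicator (?E k m) x
      + (\<Sum>j<n. indicator (D j) y * (of_bool (0 < k j) * indicator (?E (k(j := k j - 1)) m) x) :: ennreal)" .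
  qed
  also have "\<dots> = (\<integral>\<^sup>+x. emeasure \<mu> ?R * indicator (?E k m) x
      + (\<Sum>j<n. emeasure \<mu> (D j) * (of_bool (0 < k j) * indicator (?E (k(j := k j - 1)) m) x)) \<partial>?P m)"
  proof (intro nn_integral_cong)
    fix x
    show "(\<integral>\<^sup>+y. indicator ?R y * indicator (?E k m) x
      + (\<Sum>j<n. indicator (D j) y * (of_bool (0 < k j) * indicator (?E (k(j := k j - 1)) m) x)) \<partial>\<mu>)
      = emeasure \<mu> ?R * indicator (?E k m) x
      + (\<Sum>j<n. emeasure \<mu> (D j) * (of_bool (0 < k j) * indicator (?E (k(j := k j - 1)) m) x))"
      using R by (rule integral)
  qed
  also have "\<dots> = emeasure \<mu> ?R * e k m
    + (\<Sum>j<n. emeasure \<mu> (D j) * (of_bool (0 < k j) * e (k(j := k j - 1)) m))"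
    unfolding e_def by (simp add: nn_integral_add nn_integral_sum nn_integral_cmult E' E)
  finally show ?thesis .
qed

text \<open>For \<open>s \<le> m\<close> this splits the factor m + 1 as (m + 1 - s) + s. At
  \<open>s = 0\<close> the truncated \<open>s - 1\<close> is harmless because of the factor
  \<open>real s\<close>.\<close>

lemma multinomial_weight_Suc:
  fixes w :: real
  defines "g \<equiv> \<lambda>m s. if s \<le> m then w ^ (m - s) / fact (m - s) else 0"
  shows "real (Suc m) * g (Suc m) s = w * g m s + real s * g m (s - 1)"
proof (cases "s \<le> m")
  case True
  then obtain t where m: "m = s + t"
    using le_Suc_ex by blast
  have 1: "w * g m s = real (Suc t) * g (Suc m) s"
  proof -
    have "g m s = w ^ t / fact t" "g (Suc m) s = (w * w ^ t) / (real (Suc t) * fact t)"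
      by (simp_all add: g_def m Suc_diff_le del: of_nat_Suc)
    then show ?thesis
      by (simp del: of_nat_Suc)
  qed
  have 2: "real s * g m (s - 1) = real s * g (Suc m) s"
    by (cases s) (auto simp: g_def m)
  show ?thesis
    unfolding 1 2 by (simp add: m algebra_simps)
next
  case False
  then consider "s = Suc m" | "s > Suc m"
    by linarith
  then show ?thesis
    by cases (auto simp: g_def)
qed

text \<open>The multinomial probability with one extra cell, the complement of all
  \<open>D j\<close>, of mass \<open>w\<close>. Induction is on \<open>m\<close> with
  \<open>k\<close> arbitrary, since the recursion lowers the entries of \<open>k\<close>.\<close>

lemma multinomial_count:
  assumes \<mu>: "prob_space \<mu>" and D: "\<forall>j<n. D j \<in> sets \<mu>"
    and disj: "disjoint_family_on D {..<n}"
  defines "w \<equiv> measure \<mu> (space \<mu> - (\<Union>j<n. D j))"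
    and "s \<equiv> \<lambda>k. \<Sum>j<n. k j"
    and "T \<equiv> \<lambda>k. \<Prod>j<n. measure \<mu> (D j) ^ k j / fact (k j)"
  shows "emeasure (Pi\<^sub>M {..<m} (\<lambda>_. \<mu>)) (count_event n D k m \<inter> space (Pi\<^sub>M {..<m} (\<lambda>_. \<mu>)))
    = ennreal (fact m * (if s k \<le> m then w ^ (m - s k) / fact (m - s k) else 0) * T k)"
proof (induction m arbitrary: k)
  case 0
  have space: "space (Pi\<^sub>M {..<0::nat} (\<lambda>_. \<mu>)) = {\<lambda>_. undefined}"
    by (simp add: space_PiM)
  show ?case
  proof (cases "\<forall>j<n. k j = 0")
    case True
    then have "count_event n D k 0 = UNIV" "s k = 0" "T k = 1"
      by (simp_all add: count_event_def s_def T_def)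
    then show ?thesis
      using prob_space.emeasure_space_1[OF prob_space_PiM[of "{..<0::nat}" "\<lambda>_. \<mu>"]] \<mu> by simp
  next
    case False
    then have "count_event n D k 0 = {}" "s k \<noteq> 0"
      by (auto simp: count_event_def s_def)
    then show ?thesis
      by simp
  qed
next
  case (Suc m)
  interpret \<mu>: prob_space \<mu> by fact
  define g where "g m s = (if s \<le> m then w ^ (m - s) / fact (m - s) else 0)" for m s
  have w: "0 \<le> w" and g: "0 \<le> g m s" for m s
    by (simp_all add: w_def g_def)
  have T: "0 \<le> T k" for k
    by (auto simp: T_def intro!: prod_nonneg)
  \<comment> \<open>Removing a point from cell \<open>j\<close> multiplies the weights by
    \<open>k j\<close>, so the remaining factor no longer depends on \<open>j\<close> and the sum
    over the cells yields \<open>s k\<close>.\<close>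
  have step: "measure \<mu> (D j) * (of_bool (0 < k j) * (fact m * g m (s (k(j := k j - 1))) * T (k(j := k j - 1))))
      = real (k j) * (fact m * g m (s k - 1) * T k)" if j: "j < n" for j
  proof (cases "k j")
    case (Suc l)
    have "s k = Suc (s (k(j := k j - 1)))"
      unfolding s_def using j Suc by (simp add: sum.remove[of "{..<n}" j])
    moreover have "measure \<mu> (D j) * T (k(j := k j - 1)) = real (k j) * T k"
      unfolding T_def using j Suc by (simp add: prod.remove[of "{..<n}" j] field_simps del: of_nat_Suc)
    ultimately show ?thesis
      using Suc by (simp add: ac_simps)
  qed simp
  have "emeasure (Pi\<^sub>M {..<Suc m} (\<lambda>_. \<mu>)) (count_event n D k (Suc m) \<inter> space (Pi\<^sub>M {..<Suc m} (\<lambda>_. \<mu>)))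
      = ennreal w * ennreal (fact m * g m (s k) * T k)
        + (\<Sum>j<n. ennreal (measure \<mu> (D j)) * (of_bool (0 < k j) * ennreal (fact m * g m (s (k(j := k j - 1))) * T (k(j := k j - 1)))))"
    unfolding count_event_Suc[OF \<mu> D disj] Suc.IH w_def[symmetric] \<mu>.emeasure_eq_measure g_def ..
  also have "(\<Sum>j<n. ennreal (measure \<mu> (D j)) * (of_bool (0 < k j) * ennreal (fact m * g m (s (k(j := k j - 1))) * T (k(j := k j - 1)))))
      = (\<Sum>j<n. ennreal (real (k j) * (fact m * g m (s k - 1) * T k)))"
  proof (intro sum.cong refl)
    fix j assume "j \<in> {..<n}"
    then have "j < n" by simp
    show "ennreal (measure \<mu> (D j)) * (of_bool (0 < k j) * ennreal (fact m * g m (s (k(j := k j - 1))) * T (k(j := k j - 1))))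
      = ennreal (real (k j) * (fact m * g m (s k - 1) * T k))"
      unfolding step[OF \<open>j < n\<close>, symmetric]
      by (cases "0 < k j") (simp_all add: ennreal_mult' del: fun_upd_apply)
  qed
  also have "\<dots> = ennreal (real (s k) * (fact m * g m (s k - 1) * T k))"
    using g T by (subst sum_ennreal) (auto simp: s_def sum_distrib_right)
  also have "ennreal w * ennreal (fact m * g m (s k) * T k) + ennreal (real (s k) * (fact m * g m (s k - 1) * T k))
      = ennreal (w * (fact m * g m (s k) * T k) + real (s k) * (fact m * g m (s k - 1) * T k))"
    using w g T by (simp add: ennreal_mult')
  also have "w * (fact m * g m (s k) * T k) + real (s k) * (fact m * g m (s k - 1) * T k)
      = fact m * T k * (w * g m (s k) + real (s k) * g m (s k - 1))"
    by (simp add: algebra_simps)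
  also have "\<dots> = fact (Suc m) * g (Suc m) (s k) * T k"
    using multinomial_weight_Suc[where w=w and m=m and s="s k"] by (simp add: g_def)
  finally show ?case
    by (simp only: g_def)
qed

text \<open>Poissonization: a Poisson number of independent points has independent Poisson counts in
  disjoint sets. The factor \<open>fact m\<close> cancels, and summing over the points outside all
  \<open>D j\<close> gives \<open>exp (r * w)\<close>.\<close>

lemma poisson_multinomial_suminf:
  assumes \<mu>: "prob_space \<mu>" and D: "\<forall>j<n. D j \<in> sets \<mu>"
    and disj: "disjoint_family_on D {..<n}" and r: "0 < r"
  shows "(\<Sum>m. ennreal (pmf (poisson_pmf r) m)
      * emeasure (Pi\<^sub>M {..<m} (\<lambda>_. \<mu>)) (count_event n D k m \<inter> space (Pi\<^sub>M {..<m} (\<lambda>_. \<mu>))))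
    = ennreal (\<Prod>j<n. (r * measure \<mu> (D j)) ^ k j / fact (k j) * exp (- (r * measure \<mu> (D j))))"
proof -
  interpret \<mu>: prob_space \<mu> by fact
  define w where "w = measure \<mu> (space \<mu> - (\<Union>j<n. D j))"
  define s where "s = (\<Sum>j<n. k j)"
  define T where "T = (\<Prod>j<n. measure \<mu> (D j) ^ k j / fact (k j))"
  have w: "0 \<le> w" and T: "0 \<le> T"
    by (auto simp: w_def T_def intro!: prod_nonneg)
  have w_eq: "w = 1 - (\<Sum>j<n. measure \<mu> (D j))"
  proof -
    have "(\<Union>j<n. D j) \<in> sets \<mu>"
      using D by auto
    moreover have "measure \<mu> (\<Union>j<n. D j) = (\<Sum>j<n. measure \<mu> (D j))"
      using D disj by (intro \<mu>.finite_measure_finite_Union) auto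
    ultimately show ?thesis
      by (simp add: w_def \<mu>.prob_compl)
  qed
  \<comment> \<open>The terms after cancelling \<open>fact m\<close>; they vanish for
    \<open>m < s\<close>, so shifting by \<open>s\<close> leaves an exponential series.\<close>
  define f where "f m = exp (- r) * T * (r ^ m * (if s \<le> m then w ^ (m - s) / fact (m - s) else 0))" for m
  have "(\<lambda>t. (r * w) ^ t /\<^sub>R fact t) sums exp (r * w)"
    by (rule exp_converges)
  then have "(\<lambda>t. exp (- r) * T * r ^ s * ((r * w) ^ t /\<^sub>R fact t)) sums (exp (- r) * T * r ^ s * exp (r * w))"
    by (rule sums_mult)
  moreover have "exp (- r) * T * r ^ s * ((r * w) ^ t /\<^sub>R fact t) = f (t + s)" for t
    by (simp add: f_def power_add power_mult_distrib field_simps)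
  ultimately have "(\<lambda>t. f (t + s)) sums (exp (- r) * T * r ^ s * exp (r * w))"
    by simp
  moreover have "(\<Sum>i<s. f i) = 0"
    by (intro sum.neutral) (auto simp: f_def)
  ultimately have f: "f sums (exp (- r) * T * r ^ s * exp (r * w))"
    by (simp add: sums_iff_shift)
  have "ennreal (pmf (poisson_pmf r) m)
      * emeasure (Pi\<^sub>M {..<m} (\<lambda>_. \<mu>)) (count_event n D k m \<inter> space (Pi\<^sub>M {..<m} (\<lambda>_. \<mu>))) = ennreal (f m)" for m
    unfolding multinomial_count[OF \<mu> D disj] w_def[symmetric] s_def[symmetric] T_def[symmetric]
    using r by (simp add: f_def ennreal_mult'[symmetric] ac_simps)
  then have "(\<Sum>m. ennreal (pmf (poisson_pmf r) m)
      * emeasure (Pi\<^sub>M {..<m} (\<lambda>_. \<mu>)) (count_event n D k m \<inter> space (Pi\<^sub>M {..<m} (\<lambda>_. \<mu>)))) = (\<Sum>m. ennreal (f m))"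
    by simp
  also have "\<dots> = ennreal (exp (- r) * T * r ^ s * exp (r * w))"
  proof (rule suminf_ennreal_eq[OF _ f])
    show "0 \<le> f m" for m
      using r w T by (simp add: f_def)
  qed
  also have "exp (- r) * T * r ^ s * exp (r * w)
      = (\<Prod>j<n. (r * measure \<mu> (D j)) ^ k j / fact (k j) * exp (- (r * measure \<mu> (D j))))"
  proof -
    have "exp (- r) * exp (r * w) = exp (\<Sum>j<n. - (r * measure \<mu> (D j)))"
      by (simp add: w_eq sum_negf sum_distrib_left algebra_simps flip: exp_add)
    also have "\<dots> = (\<Prod>j<n. exp (- (r * measure \<mu> (D j))))"
      by (rule exp_sum) simp
    finally have "exp (- r) * T * r ^ s * exp (r * w) = T * r ^ s * (\<Prod>j<n. exp (- (r * measure \<mu> (D j))))"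
      by (simp add: ac_simps)
    also have "\<dots> = (\<Prod>j<n. (r * measure \<mu> (D j)) ^ k j / fact (k j) * exp (- (r * measure \<mu> (D j))))"
      by (simp add: T_def s_def power_sum power_mult_distrib prod.distrib[symmetric] ac_simps)
    finally show ?thesis .
  qed
  finally show ?thesis .
qed

section \<open>Mixtures of independent points\<close>

lemma emeasure_points_config:
  assumes "A \<in> sets borel"
  shows "emeasure (points_config n x) A = of_nat (card {i. i < n \<and> x i \<in> A})"
proof -
  have "emeasure (points_config n x) A = emeasure (count_space {..<n}) (x -` A \<inter> {..<n})"
    unfolding points_config_def using assms by (subst emeasure_distr) auto
  also have "x -` A \<inter> {..<n} = {i. i < n \<and> x i \<in> A}"
    by auto
  also have "emeasure (count_space {..<n}) \<dots> = of_nat (card {i. i < n \<and> x i \<in> A})"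
    by (rule emeasure_count_space_finite) auto
  finally show ?thesis .
qed

lemma points_config_in_configurations: "points_config n x \<in> configurations"
proof -
  have "of_nat k \<in> range ennreal_of_enat" for k
    by (rule range_eqI[of _ _ "enat k"]) simp
  moreover have "of_nat k < (\<top> :: ennreal)" for k
    by (simp add: ennreal_of_nat_eq_real_of_nat)
  moreover have "sets (points_config n x) = sets borel"
    by (simp add: points_config_def)
  ultimately show ?thesis
    unfolding configurations_def rel_compact_borel_def by (auto simp: emeasure_points_config)
qed

lemma points_config_cong:
  assumes "\<And>i. i < n \<Longrightarrow> x i = y i"
  shows "points_config n x = points_config n y"
  unfolding points_config_def using assms by (intro distr_cong) auto

text \<open>Both configurations are initial segments of the same sequence, so their counts in any
  set differ by at most the number of points in only one segment.\<close>

lemma tv_dist_points_config_le: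
  "tv_dist (points_config n x) (points_config m x) \<le> ennreal \<bar>real n - real m\<bar>"
proof -
  have sub: "\<bar>real (card {i. i < a \<and> x i \<in> A}) - real (card {i. i < b \<and> x i \<in> A})\<bar> \<le> real b - real a"
    if "a \<le> b" for a b A
  proof -
    have "card {i. i < b \<and> x i \<in> A} = card ({i. i < a \<and> x i \<in> A} \<union> {i. a \<le> i \<and> i < b \<and> x i \<in> A})"
      using that by (intro arg_cong[where f=card]) auto
    also have "\<dots> = card {i. i < a \<and> x i \<in> A} + card {i. a \<le> i \<and> i < b \<and> x i \<in> A}"
      by (rule card_Un_disjoint) auto
    finally have "card {i. i < b \<and> x i \<in> A} = card {i. i < a \<and> x i \<in> A} + card {i. a \<le> i \<and> i < b \<and> x i \<in> A}" .
    moreover have "card {i. a \<le> i \<and> i < b \<and> x i \<in> A} \<le> card {a..<b}"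
      by (rule card_mono) auto
    ultimately show ?thesis
      using that by (simp add: of_nat_diff)
  qed
  have "\<bar>real (card {i. i < n \<and> x i \<in> A}) - real (card {i. i < m \<and> x i \<in> A})\<bar> \<le> \<bar>real n - real m\<bar>" for A
    using sub[of n m A] sub[of m n A] by (cases "n \<le> m") (auto simp: abs_minus_commute)
  then show ?thesis
    unfolding tv_dist_def
    by (intro SUP_least ennreal_leI) (auto simp: measure_def emeasure_points_config)
qed

lemma points_config_in_cylinder_iff:
  assumes "\<And>j. j < n \<Longrightarrow> D j \<in> rel_compact_borel"
  shows "points_config m x \<in> cylinder n D k \<longleftrightarrow> x \<in> count_event n D k m"
  using assms points_config_in_configurations[of m x]
  by (auto simp: cylinder_def count_event_def emeasure_points_config rel_compact_borel_def)

text \<open>The index set \<open>I\<close> is left open to serve both the finite products and the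
  infinite product of the coupling.\<close>

lemma measurable_points_config:
  assumes "sets \<mu> = sets borel" "{..<n} \<subseteq> I"
  shows "points_config n \<in> measurable (Pi\<^sub>M I (\<lambda>_. \<mu>)) config_space"
proof (rule measurable_into_config_space)
  fix A :: "'a set" assume A: "A \<in> rel_compact_borel"
  then have [measurable]: "A \<in> sets \<mu>"
    using assms by (simp add: rel_compact_borel_def)
  have m: "(\<lambda>x. indicator A (x i) :: ennreal) \<in> borel_measurable (Pi\<^sub>M I (\<lambda>_. \<mu>))" if "i \<in> {..<n}" for i
  proof -
    have [measurable]: "i \<in> I"
      using that assms by auto
    show ?thesis
      by measurable
  qed
  have "emeasure (points_config n x) A = (\<Sum>i<n. indicator A (x i))" for x
    using A by (simp add: emeasure_points_config rel_compact_borel_def indicator_def sum.If_cases Int_def)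
  then show "(\<lambda>x. emeasure (points_config n x) A) \<in> borel_measurable (Pi\<^sub>M I (\<lambda>_. \<mu>))"
    using m by (simp add: borel_measurable_sum)
qed (rule points_config_in_configurations)

section \<open>A common probability space: a uniform variable and an independent infinite
  sample\<close>

abbreviation coupling_space :: "'a measure \<Rightarrow> (real \<times> (nat \<Rightarrow> 'a)) measure" where
  "coupling_space \<mu> \<equiv> unif \<Otimes>\<^sub>M Pi\<^sub>M UNIV (\<lambda>_. \<mu>)"

text \<open>The uniform variable selects how many points of the sequence are kept. Processes with
  different \<open>p\<close> evaluated at the same \<open>\<omega>\<close> share their points, which
  is the coupling used below.\<close>

definition mixed_config :: "nat pmf \<Rightarrow> real \<times> (nat \<Rightarrow> 'a::metric_space) \<Rightarrow> 'a measure" where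
  "mixed_config p \<omega> = points_config (quantile p (fst \<omega>)) (snd \<omega>)"

lemma measurable_quantile_unif: "quantile p \<in> measurable unif (count_space UNIV)"
  by (intro measurable_restrict_space1) simp

lemma measurable_mixed_config:
  assumes "sets \<mu> = sets borel"
  shows "mixed_config p \<in> measurable (coupling_space \<mu>) config_space"
proof -
  have "(\<lambda>\<omega>. points_config n (snd \<omega>)) \<in> measurable (coupling_space \<mu>) config_space" for n
    using measurable_points_config[OF assms subset_UNIV] by (rule measurable_compose[OF measurable_snd])
  moreover have "(\<lambda>\<omega>. quantile p (fst \<omega>)) \<in> measurable (coupling_space \<mu>) (count_space UNIV)"
    using measurable_quantile_unif by (rule measurable_compose[OF measurable_fst])
  ultimately show ?thesis
    unfolding mixed_config_def by (rule measurable_compose_countable)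
qed

text \<open>By Fubini the uniform variable is fixed first; the configuration then depends on
  finitely many coordinates, whose joint law is the finite product. The number of points has law
  \<open>p\<close> by \<open>distr_quantile\<close>.\<close>

lemma emeasure_mixed_config:
  assumes \<mu>: "prob_space \<mu>" "sets \<mu> = sets borel" and B: "B \<in> sets config_space"
  shows "emeasure (distr (coupling_space \<mu>) config_space (mixed_config p)) B
    = (\<Sum>n. ennreal (pmf p n) * emeasure (Pi\<^sub>M {..<n} (\<lambda>_. \<mu>)) (points_config n -` B \<inter> space (Pi\<^sub>M {..<n} (\<lambda>_. \<mu>))))"
proof -
  interpret \<mu>: prob_space \<mu> by fact
  let ?S = "Pi\<^sub>M UNIV (\<lambda>_::nat. \<mu>)"
  interpret S: prob_space ?S
    using \<mu>(1) by (intro prob_space_PiM)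
  interpret P: product_prob_space "\<lambda>_. \<mu>" "UNIV :: nat set" ..
  define h where "h n = emeasure ?S (points_config n -` B \<inter> space ?S)" for n
  have h: "h n = emeasure (Pi\<^sub>M {..<n} (\<lambda>_. \<mu>)) (points_config n -` B \<inter> space (Pi\<^sub>M {..<n} (\<lambda>_. \<mu>)))" for n
  proof -
    let ?Pn = "Pi\<^sub>M {..<n} (\<lambda>_. \<mu>)"
    have m: "points_config n -` B \<inter> space ?Pn \<in> sets ?Pn"
      using measurable_points_config[OF \<mu>(2) order_refl] B by (rule measurable_sets)
    have r: "(\<lambda>x. restrict x {..<n}) \<in> measurable ?S ?Pn"
      by (rule measurable_restrict_subset) simp
    have "emeasure ?Pn (points_config n -` B \<inter> space ?Pn)
        = emeasure (distr ?S ?Pn (\<lambda>x. restrict x {..<n})) (points_config n -` B \<inter> space ?Pn)"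
      by (subst P.distr_PiM_restrict_finite) auto
    also have "\<dots> = emeasure ?S ((\<lambda>x. restrict x {..<n}) -` (points_config n -` B \<inter> space ?Pn) \<inter> space ?S)"
      using r m by (rule emeasure_distr)
    also have "(\<lambda>x. restrict x {..<n}) -` (points_config n -` B \<inter> space ?Pn) \<inter> space ?S
        = points_config n -` B \<inter> space ?S"
    proof -
      have "points_config n (restrict x {..<n}) = points_config n x" for x :: "nat \<Rightarrow> 'a"
        by (rule points_config_cong) simp
      moreover have "restrict x {..<n} \<in> space ?Pn" if "x \<in> space ?S" for x
        using r that by (rule measurable_space)
      ultimately show ?thesis
        by auto
    qed
    finally show ?thesis
      by (simp add: h_def)
  qed
  have sets: "mixed_config p -` B \<inter> space (coupling_space \<mu>) \<in> sets (coupling_space \<mu>)"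
    using measurable_mixed_config[OF \<mu>(2)] B by (rule measurable_sets)
  have "emeasure (distr (coupling_space \<mu>) config_space (mixed_config p)) B
      = emeasure (coupling_space \<mu>) (mixed_config p -` B \<inter> space (coupling_space \<mu>))"
    using measurable_mixed_config[OF \<mu>(2)] B by (rule emeasure_distr)
  also have "\<dots> = (\<integral>\<^sup>+u. emeasure ?S (Pair u -` (mixed_config p -` B \<inter> space (coupling_space \<mu>))) \<partial>unif)"
    using sets by (rule S.emeasure_pair_measure_alt)
  also have "\<dots> = (\<integral>\<^sup>+u. h (quantile p u) \<partial>unif)"
  proof (rule nn_integral_cong)
    fix u assume "u \<in> space unif"
    then have "Pair u -` (mixed_config p -` B \<inter> space (coupling_space \<mu>))
        = points_config (quantile p u) -` B \<inter> space ?S"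
      by (auto simp: space_pair_measure mixed_config_def)
    then show "emeasure ?S (Pair u -` (mixed_config p -` B \<inter> space (coupling_space \<mu>))) = h (quantile p u)"
      by (simp add: h_def)
  qed
  also have "\<dots> = (\<integral>\<^sup>+n. h n \<partial>distr unif (count_space UNIV) (quantile p))"
    by (rule nn_integral_distr[symmetric, OF measurable_quantile_unif]) simp
  also have "\<dots> = (\<Sum>n. ennreal (pmf p n) * h n)"
    unfolding distr_quantile by (simp add: nn_integral_measure_pmf nn_integral_count_space_nat)
  finally show ?thesis
    unfolding h .
qed

text \<open>The events \<open>E n\<close> are disjoint and have total probability 1, so the law is
  the mixture of its conditional laws given the number of points.\<close>

lemma purely_random_pp_law:
  assumes pp: "purely_random_pp P \<Phi> \<mu> p" and pos: "\<And>n. pmf p n \<noteq> 0"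
  shows "pp_law P \<Phi> = distr (coupling_space \<mu>) config_space (mixed_config p)"
proof (rule measure_eqI)
  have P: "prob_space P" and \<Phi>: "\<Phi> \<in> measurable P config_space"
    and \<mu>: "prob_space \<mu>" "sets \<mu> = sets borel"
    and N: "\<And>n. \<P>(\<omega> in P. emeasure (\<Phi> \<omega>) UNIV = of_nat n) = pmf p n"
    and cond: "\<And>n B. B \<in> sets config_space \<Longrightarrow>
          \<P>(\<omega> in P. \<Phi> \<omega> \<in> B \<bar> emeasure (\<Phi> \<omega>) UNIV = of_nat n)
            = \<P>(x in Pi\<^sub>M {..<n} (\<lambda>_. \<mu>). points_config n x \<in> B)"
    using pp pos by (auto simp: purely_random_pp_def point_process_def)
  interpret P: prob_space P by fact
  show "sets (pp_law P \<Phi>) = sets (distr (coupling_space \<mu>) config_space (mixed_config p))"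
    by (simp add: pp_law_def)
  fix B assume "B \<in> sets (pp_law P \<Phi>)"
  then have B: "B \<in> sets config_space"
    by (simp add: pp_law_def)
  define E where "E n = {\<omega> \<in> space P. emeasure (\<Phi> \<omega>) UNIV = of_nat n}" for n :: nat
  define F where "F = \<Phi> -` B \<inter> space P"
  have F: "F \<in> P.events"
    unfolding F_def using \<Phi> B by (rule measurable_sets)
  have prob_E: "P.prob (E n) = pmf p n" for n
    using N by (simp add: E_def)
  \<comment> \<open>Evaluation at the whole space need not be measurable on \<open>config_space\<close>; here it is, because a
    non-measurable set would get the junk value 0, which \<open>pmf p n\<close> is not.\<close>
  have E: "E n \<in> P.events" for n
    using prob_E[of n] pos[of n] by (metis measure_notin_sets)
  have disj: "disjoint_family E"
    by (auto simp: disjoint_family_on_def E_def)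
  have "emeasure P (\<Union>n. E n) = (\<Sum>n. emeasure P (E n))"
    using E disj by (intro suminf_emeasure[symmetric]) auto
  also have "\<dots> = emeasure (measure_pmf p) UNIV"
    by (simp add: P.emeasure_eq_measure prob_E emeasure_pmf_suminf del: measure_pmf.emeasure_space_1)
  also have "\<dots> = 1"
    using measure_pmf.emeasure_space_1[of p] by simp
  finally have "AE \<omega> in P. \<omega> \<in> (\<Union>n. E n)"
    using E by (intro P.AE_prob_1) (simp add: P.emeasure_eq_measure)
  then have "emeasure P F = emeasure P (\<Union>n. F \<inter> E n)"
    using E F by (intro emeasure_eq_AE) auto
  also have "\<dots> = (\<Sum>n. emeasure P (F \<inter> E n))"
    using E F disj by (intro suminf_emeasure[symmetric]) (auto simp: disjoint_family_on_def)
  also have "\<dots> = (\<Sum>n. ennreal (pmf p n) * emeasure (Pi\<^sub>M {..<n} (\<lambda>_. \<mu>)) (points_config n -` B \<inter> space (Pi\<^sub>M {..<n} (\<lambda>_. \<mu>))))"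
  proof (intro suminf_cong)
    fix n :: nat
    let ?Pn = "Pi\<^sub>M {..<n} (\<lambda>_. \<mu>)"
    interpret Pn: prob_space ?Pn
      using \<mu>(1) by (intro prob_space_PiM)
    have "P.prob (F \<inter> E n) / P.prob (E n) = measure ?Pn (points_config n -` B \<inter> space ?Pn)"
    proof -
      have "F \<inter> E n = {\<omega> \<in> space P. \<Phi> \<omega> \<in> B \<and> emeasure (\<Phi> \<omega>) UNIV = of_nat n}"
        by (auto simp: F_def E_def)
      moreover have "points_config n -` B \<inter> space ?Pn = {x \<in> space ?Pn. points_config n x \<in> B}"
        by auto
      ultimately show ?thesis
        using cond[OF B, of n] by (simp add: cond_prob_def E_def)
    qed
    then have "P.prob (F \<inter> E n) = pmf p n * measure ?Pn (points_config n -` B \<inter> space ?Pn)"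
      using pos[of n] by (simp add: prob_E field_simps)
    then show "emeasure P (F \<inter> E n) = ennreal (pmf p n) * emeasure ?Pn (points_config n -` B \<inter> space ?Pn)"
      by (simp add: P.emeasure_eq_measure Pn.emeasure_eq_measure ennreal_mult')
  qed
  also have "\<dots> = emeasure (distr (coupling_space \<mu>) config_space (mixed_config p)) B"
    using emeasure_mixed_config[OF \<mu> B] ..
  finally show "emeasure (pp_law P \<Phi>) B = emeasure (distr (coupling_space \<mu>) config_space (mixed_config p)) B"
    using \<Phi> B by (simp add: pp_law_def emeasure_distr F_def)
qed

lemma prob_space_coupling_space:
  assumes "prob_space \<mu>"
  shows "prob_space (coupling_space \<mu>)"
proof -
  have S: "prob_space (Pi\<^sub>M UNIV (\<lambda>_::nat. \<mu>))"
    using assms by (intro prob_space_PiM)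
  show ?thesis
    using prob_space_unif S by (rule prob_space_pair)
qed

text \<open>Both laws are compared on cylinders over disjoint sets: independence of the Poisson
  counts gives a product on one side, and Poissonization gives the same product on the
  other.\<close>

lemma poisson_pp_law:
  assumes pp: "poisson_pp Q \<zeta> M" and \<mu>: "prob_space \<mu>" "sets \<mu> = sets borel" and r: "0 < r"
    and M: "\<forall>A\<in>sets borel. measure M A = r * measure \<mu> A"
  shows "pp_law Q \<zeta> = distr (coupling_space \<mu>) config_space (mixed_config (poisson_pmf r))"
proof (rule config_law_eqI)
  have Q: "prob_space Q" and \<zeta>: "\<zeta> \<in> measurable Q config_space"
    and prob: "\<And>A k. A \<in> rel_compact_borel \<Longrightarrow>
          \<P>(\<omega> in Q. emeasure (\<zeta> \<omega>) A = of_nat k) = measure M A ^ k / fact k * exp (- measure M A)"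
    and indep: "\<And>(n::nat) A. (\<forall>i<n. A i \<in> rel_compact_borel) \<Longrightarrow> disjoint_family_on A {..<n} \<Longrightarrow>
          prob_space.indep_vars Q (\<lambda>_. borel) (\<lambda>i \<omega>. emeasure (\<zeta> \<omega>) (A i)) {..<n}"
    using pp unfolding poisson_pp_def point_process_def by blast+
  interpret Q: prob_space Q by fact
  show "prob_space (pp_law Q \<zeta>)"
    unfolding pp_law_def using \<zeta> by (rule Q.prob_space_distr)
  show "prob_space (distr (coupling_space \<mu>) config_space (mixed_config (poisson_pmf r)))"
    using prob_space_coupling_space[OF \<mu>(1)] measurable_mixed_config[OF \<mu>(2)]
    by (rule prob_space.prob_space_distr)
  fix n and D :: "nat \<Rightarrow> 'b set" and k
  assume D: "\<And>i. i < n \<Longrightarrow> D i \<in> rel_compact_borel" and disj: "disjoint_family_on D {..<n}"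
  have Db: "\<forall>j<n. D j \<in> sets \<mu>"
    using D \<mu>(2) by (simp add: rel_compact_borel_def)
  have cyl: "cylinder n D k \<in> sets config_space"
    using D by (rule sets_cylinder)
  let ?c = "ennreal (\<Prod>j<n. (r * measure \<mu> (D j)) ^ k j / fact (k j) * exp (- (r * measure \<mu> (D j))))"
  have "emeasure (pp_law Q \<zeta>) (cylinder n D k) = ?c"
  \<comment> \<open>With no constraints the intersection over \<open>i < n\<close> would be
    \<open>UNIV\<close> rather than \<open>space Q\<close>, so this case is treated apart.\<close>
  proof (cases "n = 0")
    case True
    then have "cylinder n D k = space config_space"
      by (simp add: cylinder_def space_config_space)
    then show ?thesis
      using True prob_space.emeasure_space_1[OF \<open>prob_space (pp_law Q \<zeta>)\<close>]
      by (simp add: pp_law_def)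
  next
    case False
    let ?X = "\<lambda>i \<omega>. emeasure (\<zeta> \<omega>) (D i)"
    have conf: "\<zeta> \<omega> \<in> configurations" if "\<omega> \<in> space Q" for \<omega>
      using measurable_space[OF \<zeta> that] by (simp add: space_config_space)
    have "emeasure (pp_law Q \<zeta>) (cylinder n D k) = emeasure Q (\<zeta> -` cylinder n D k \<inter> space Q)"
      unfolding pp_law_def using \<zeta> cyl by (rule emeasure_distr)
    also have "\<zeta> -` cylinder n D k \<inter> space Q = (\<Inter>i\<in>{..<n}. ?X i -` {of_nat (k i)} \<inter> space Q)"
      using conf False by (auto simp: cylinder_def)
    also have "emeasure Q \<dots> = ennreal (Q.prob (\<Inter>i\<in>{..<n}. ?X i -` {of_nat (k i)} \<inter> space Q))"
      by (rule Q.emeasure_eq_measure)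
    also have "Q.prob (\<Inter>i\<in>{..<n}. ?X i -` {of_nat (k i)} \<inter> space Q)
        = (\<Prod>i<n. Q.prob (?X i -` {of_nat (k i)} \<inter> space Q))"
      using indep[of n D] D disj False by (intro Q.indep_varsD_finite) auto
    also have "\<dots> = (\<Prod>j<n. (r * measure \<mu> (D j)) ^ k j / fact (k j) * exp (- (r * measure \<mu> (D j))))"
    proof (intro prod.cong refl)
      fix j assume "j \<in> {..<n}"
      then have j: "D j \<in> rel_compact_borel" "D j \<in> sets borel"
        using D by (auto simp: rel_compact_borel_def)
      have "?X j -` {of_nat (k j)} \<inter> space Q = {\<omega> \<in> space Q. ?X j \<omega> = of_nat (k j)}"
        by auto
      then show "Q.prob (?X j -` {of_nat (k j)} \<inter> space Q)
          = (r * measure \<mu> (D j)) ^ k j / fact (k j) * exp (- (r * measure \<mu> (D j)))"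
        using prob[OF j(1), of "k j"] M j(2) by simp
    qed
    finally show ?thesis .
  qed
  moreover have "emeasure (distr (coupling_space \<mu>) config_space (mixed_config (poisson_pmf r))) (cylinder n D k) = ?c"
  proof -
    have "points_config m -` cylinder n D k = count_event n D k m" for m
      using points_config_in_cylinder_iff[of n D m _ k, OF D] by auto
    then show ?thesis
      unfolding emeasure_mixed_config[OF \<mu> cyl] using poisson_multinomial_suminf[OF \<mu>(1) Db disj r, of k]
      by simp
  qed
  ultimately show "emeasure (pp_law Q \<zeta>) (cylinder n D k)
      = emeasure (distr (coupling_space \<mu>) config_space (mixed_config (poisson_pmf r))) (cylinder n D k)"
    by simp
qed (simp_all add: pp_law_def)

section \<open>The distance between two mixtures\<close>

text \<open>Needed for \<open>tv_dist\<close>, which need not be measurable when the space is not separable; this rules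
  out the transfer theorem \<open>nn_integral_distr\<close>.\<close>

lemma nn_integral_distr_le:
  assumes T: "T \<in> measurable N C" and le: "\<And>\<omega>. \<omega> \<in> space N \<Longrightarrow> f (T \<omega>) \<le> h \<omega>"
  shows "(\<integral>\<^sup>+\<omega>. f \<omega> \<partial>distr N C T) \<le> (\<integral>\<^sup>+\<omega>. h \<omega> \<partial>N)"
  unfolding nn_integral_def[of "distr N C T"]
proof (rule SUP_least)
  fix g assume "g \<in> {g. simple_function (distr N C T) g \<and> g \<le> f}"
  then have g: "simple_function (distr N C T) g" "g \<le> f"
    by auto
  \<comment> \<open>Each simple function \<open>g\<close> below \<open>f\<close> is measurable, so
    the transfer theorem applies to \<open>g\<close> even when \<open>f\<close> is not
    measurable.\<close>
  then have m: "g \<in> borel_measurable C"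
    using borel_measurable_simple_function by fastforce
  have "integral\<^sup>S (distr N C T) g = (\<integral>\<^sup>+\<omega>. g (T \<omega>) \<partial>N)"
    using T m g(1) by (simp add: nn_integral_eq_simple_integral[symmetric] nn_integral_distr)
  also have "\<dots> \<le> (\<integral>\<^sup>+\<omega>. h \<omega> \<partial>N)"
  proof (rule nn_integral_mono)
    fix \<omega> assume "\<omega> \<in> space N"
    then show "g (T \<omega>) \<le> h \<omega>"
      using g(2) le by (meson le_funD order_trans)
  qed
  finally show "integral\<^sup>S (distr N C T) g \<le> (\<integral>\<^sup>+\<omega>. h \<omega> \<partial>N)" .
qed

text \<open>The joint law of the two mixed configurations at the same \<open>\<omega>\<close> is a
  coupling. The distance under it is at most the difference of the numbers of points, whose mean is
  the Wasserstein sum.\<close>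

lemma tv_star_mixed_config_le:
  assumes \<mu>: "prob_space \<mu>" "sets \<mu> = sets borel"
  shows "tv_star (distr (coupling_space \<mu>) config_space (mixed_config p))
      (distr (coupling_space \<mu>) config_space (mixed_config q))
    \<le> (\<Sum>k. ennreal \<bar>upper p (Suc k) - upper q (Suc k)\<bar>)"
proof -
  let ?\<Omega> = "coupling_space \<mu>"
  let ?law = "\<lambda>p. distr ?\<Omega> config_space (mixed_config p)"
  let ?T = "\<lambda>\<omega>. (mixed_config p \<omega>, mixed_config q \<omega>)"
  let ?C = "distr ?\<Omega> (config_space \<Otimes>\<^sub>M config_space) ?T"
  interpret S: prob_space "Pi\<^sub>M UNIV (\<lambda>_::nat. \<mu>)"
    using \<mu>(1) by (intro prob_space_PiM)
  have m: "mixed_config p \<in> measurable ?\<Omega> config_space" for p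
    using \<mu>(2) by (rule measurable_mixed_config)
  have T: "?T \<in> measurable ?\<Omega> (config_space \<Otimes>\<^sub>M config_space)"
    using m m by (rule measurable_Pair)
  have "distr ?C (?law p) fst = ?law p"
  proof -
    \<comment> \<open>A target measure enters \<open>distr\<close> only through its
      \<sigma>-algebra, and \<open>?law p\<close> has that of \<open>config_space\<close>.\<close>
    have "distr ?C (?law p) fst = distr ?C config_space fst"
      by (rule distr_cong) simp_all
    also have "\<dots> = ?law p"
      using T by (subst distr_distr) (simp_all add: comp_def)
    finally show ?thesis .
  qed
  moreover have "distr ?C (?law q) snd = ?law q"
  proof -
    have "distr ?C (?law q) snd = distr ?C config_space snd"
      by (rule distr_cong) simp_all
    also have "\<dots> = ?law q"
      using T by (subst distr_distr) (simp_all add: comp_def)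
    finally show ?thesis .
  qed
  moreover have "sets ?C = sets (?law p \<Otimes>\<^sub>M ?law q)"
    by (simp cong: sets_pair_measure_cong)
  ultimately have "?C \<in> couplings (?law p) (?law q)"
    by (simp add: couplings_def)
  then have "tv_star (?law p) (?law q) \<le> (\<integral>\<^sup>+\<omega>. tv_dist (fst \<omega>) (snd \<omega>) \<partial>?C)"
    unfolding tv_star_def by (rule INF_lower)
  also have "\<dots> \<le> (\<integral>\<^sup>+\<omega>. ennreal \<bar>real (quantile p (fst \<omega>)) - real (quantile q (fst \<omega>))\<bar> \<partial>?\<Omega>)"
    using T by (rule nn_integral_distr_le) (simp add: mixed_config_def tv_dist_points_config_le)
  also have "\<dots> = (\<integral>\<^sup>+u. ennreal \<bar>real (quantile p u) - real (quantile q u)\<bar> \<partial>unif)"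
  proof -
    note [measurable] = measurable_quantile_unif
    have "(\<lambda>\<omega>. ennreal \<bar>real (quantile p (fst \<omega>)) - real (quantile q (fst \<omega>))\<bar>) \<in> borel_measurable ?\<Omega>"
      by measurable
    \<comment> \<open>The integrand ignores the point sequence, whose law has mass 1.\<close>
    then show ?thesis
      by (subst S.nn_integral_fst[symmetric]) (simp_all add: S.emeasure_space_1)
  qed
  also have "\<dots> = (\<Sum>k. ennreal \<bar>upper p (Suc k) - upper q (Suc k)\<bar>)"
    by (rule nn_integral_quantile_diff)
  finally show ?thesis .
qed

theorem theorem5p3:
  fixes L M \<mu> :: "'a::metric_space measure"
    and m :: "'a \<Rightarrow> ennreal"
    and p :: "nat pmf"
    and P :: "'w measure" and \<Phi> :: "'w \<Rightarrow> 'a measure"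
    and Q :: "'v measure" and \<zeta> :: "'v \<Rightarrow> 'a measure"
  assumes "locally compact (UNIV :: 'a set)"
    and "radon_measure L"
    and "m \<in> borel_measurable L"
    and "M = density L m"
    and "finite_measure M"
    and "\<mu> = density L (\<lambda>x. m x / emeasure M UNIV)"
    and "prob_space \<mu>"
    and "purely_random_pp P \<Phi> \<mu> p"
    and "\<And>n. pmf p n \<noteq> 0"
    and "poisson_pp Q \<zeta> M"
  shows "tv_star (pp_law P \<Phi>) (pp_law Q \<zeta>)
    \<le> (\<Sum>n. ennreal \<bar>real (n + 1) * pmf p (n + 1) - measure M UNIV * pmf p n\<bar>)"
proof -
  interpret M: finite_measure M by fact
  interpret \<mu>: prob_space \<mu> by fact
  define r where "r = measure M UNIV"
  have sets_M: "sets M = sets borel"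
    using \<open>poisson_pp Q \<zeta> M\<close> by (simp add: poisson_pp_def)
  then have sets_L: "sets L = sets borel"
    using \<open>M = density L m\<close> by simp
  have sets_\<mu>: "sets \<mu> = sets borel"
    using \<open>\<mu> = _\<close> sets_L by simp
  have space: "space \<mu> = UNIV" "space M = UNIV"
    using sets_eq_imp_space_eq[OF sets_\<mu>] sets_eq_imp_space_eq[OF sets_M] by simp_all
  have \<mu>_eq: "emeasure \<mu> A = emeasure M A / ennreal r" if "A \<in> sets borel" for A
  proof -
    have A: "A \<in> sets L"
      using that sets_L by simp
    have "emeasure \<mu> A = (\<integral>\<^sup>+x. (m x / emeasure M UNIV) * indicator A x \<partial>L)"
      unfolding \<open>\<mu> = _\<close> using A assms(3) by (intro emeasure_density) auto
    also have "\<dots> = (\<integral>\<^sup>+x. (m x * indicator A x) / emeasure M UNIV \<partial>L)"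
      by (intro nn_integral_cong) (simp add: divide_ennreal_def ac_simps)
    also have "\<dots> = (\<integral>\<^sup>+x. m x * indicator A x \<partial>L) / emeasure M UNIV"
      using A assms(3) by (intro nn_integral_divide borel_measurable_times_ennreal borel_measurable_indicator)
    also have "(\<integral>\<^sup>+x. m x * indicator A x \<partial>L) = emeasure M A"
      unfolding \<open>M = _\<close> using A assms(3) by (intro emeasure_density[symmetric]) auto
    finally show ?thesis
      by (simp add: r_def M.emeasure_eq_measure)
  qed
  \<comment> \<open>If \<open>M\<close> were zero, then \<open>\<mu>\<close> would have mass 0 / 0,
    which is 0 in \<open>ennreal\<close>, contradicting total mass 1. Positivity of \<open>r\<close>
    makes \<open>poisson_pmf r\<close> the Poisson law.\<close>
  have "r \<noteq> 0"
  proof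
    assume "r = 0"
    then have "emeasure M UNIV = 0"
      by (simp add: r_def M.emeasure_eq_measure)
    then have "emeasure \<mu> UNIV = 0"
      using \<mu>_eq[of UNIV] by (simp add: divide_ennreal_def)
    then show False
      using \<mu>.emeasure_space_1 space by simp
  qed
  then have r: "0 < r"
    by (simp add: r_def less_le)
  have M_eq: "\<forall>A\<in>sets borel. measure M A = r * measure \<mu> A"
  proof
    fix A :: "'a set" assume A: "A \<in> sets borel"
    have "ennreal (measure \<mu> A) = ennreal (measure M A / r)"
      using \<mu>_eq[OF A] r by (simp add: M.emeasure_eq_measure \<mu>.emeasure_eq_measure divide_ennreal)
    then show "measure M A = r * measure \<mu> A"
      using r by (simp add: field_simps)
  qed
  have "tv_star (pp_law P \<Phi>) (pp_law Q \<zeta>)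
      \<le> (\<Sum>k. ennreal \<bar>upper p (Suc k) - upper (poisson_pmf r) (Suc k)\<bar>)"
    unfolding purely_random_pp_law[OF assms(8,9)]
      poisson_pp_law[OF \<open>poisson_pp Q \<zeta> M\<close> \<open>prob_space \<mu>\<close> sets_\<mu> r M_eq]
    using \<open>prob_space \<mu>\<close> sets_\<mu> by (rule tv_star_mixed_config_le)
  also have "\<dots> \<le> (\<Sum>n. ennreal \<bar>real (n + 1) * pmf p (n + 1) - r * pmf p n\<bar>)"
    using r by (rule poisson_transport_bound)
  finally show ?thesis
    unfolding r_def .
qed

end
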